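(* Let $\gamma>0$ and let $g(t)=\sqrt{2\gamma}\,e^{-\gamma t}\chi_{\mathbb{R}_+}(t)$, $t\in\mathbb{R}$. Fix $n\in\mathbb{N}$ and consider the Gabor systems $\mathcal{G}(g,a\mathbb{Z}\times b\mathbb{Z})$ with $a,b>0$ and $(ab)^{-1}=n$. Among these lattices: (1) the frame condition number is minimal only for the lattice $(a_0/n)\mathbb{Z}\times(1/a_0)\mathbb{Z}$ with $$a_0=\frac{\operatorname{arcsinh}(n)}{\gamma};$$ (2) the sharp lower frame bound has a unique maximizing lattice $(a_+/n)\mathbb{Z}\times(1/a_+)\mathbb{Z}$, $a_+>0$, and $$a_+<\frac{\operatorname{arcsinh}(n)}{\gamma};$$ (3) the sharp upper frame bound has a unique minimizing lattice $(a^-/n)\mathbb{Z}\times(1/a^-)\mathbb{Z}$, $a^->0$, and $$a^->\frac{\operatorname{arcsinh}(n)}{\gamma}.$$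
   Context: For $g\in L^2(\mathbb{R})$ and $\lambda=(x,\omega)\in\mathbb{R}^2$ put $\pi(\lambda)g(t) = g(t-x)e^{2\pi i\omega t}$. For a lattice $\Lambda\subset\mathbb{R}^2$ the Gabor system is $\mathcal{G}(g,\Lambda)=\{\pi(\lambda)g \mid \lambda\in\Lambda\}$. The sharp lower and upper frame bounds are the largest constant $A\geq 0$ and the smallest constant $B$ such that $A\|f\|_2^2 \le \sum_{\lambda\in\Lambda}|\langle f,\pi(\lambda)g\rangle|^2 \le B\|f\|_2^2$ for all $f\in L^2(\mathbb{R})$. The frame condition number is $B/A$. $\chi_{\mathbb{R}_+}$ denotes the indicator function of $\mathbb{R}_+=(0,\infty)$, and $\mathbb{N}=\{1,2,3,\dots\}$. Every pair $(a,b)$ of positive numbers with $(ab)^{-1}=n$ is of the form $(\eta/n,1/\eta)$ with a unique $\eta>0$. *)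

theory Defs
  imports "HOL-Analysis.Analysis"
begin

text \<open>Elements of \<open>L\<^sup>2(\<real>)\<close> are represented by functions; nothing below distinguishes functions that
  agree almost everywhere.\<close>

definition L2 :: "(real \<Rightarrow> complex) set" where
  "L2 = {f. f \<in> borel_measurable lborel \<and> integrable lborel (\<lambda>t. (cmod (f t))\<^sup>2)}"

definition L2_norm :: "(real \<Rightarrow> complex) \<Rightarrow> real" where
  "L2_norm f = sqrt (LINT t|lborel. (cmod (f t))\<^sup>2)"

definition L2_inner :: "(real \<Rightarrow> complex) \<Rightarrow> (real \<Rightarrow> complex) \<Rightarrow> complex" where
  "L2_inner f h = (LINT t|lborel. f t * cnj (h t))"

definition tf_shift :: "real \<times> real \<Rightarrow> (real \<Rightarrow> complex) \<Rightarrow> real \<Rightarrow> complex" where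
  "tf_shift = (\<lambda>(x, \<omega>) g t. g (t - x) * exp (2 * of_real pi * \<i> * of_real \<omega> * of_real t))"

text \<open>The sum over the Gabor system and the frame bounds take values in \<open>[0, \<infinity>]\<close>, so that a divergent
  sum is \<open>\<infinity>\<close> and a system without a finite upper bound has sharp upper frame bound \<open>\<infinity>\<close>.\<close>

definition gabor_sum :: "(real \<Rightarrow> complex) \<Rightarrow> (real \<times> real) set \<Rightarrow> (real \<Rightarrow> complex) \<Rightarrow> ennreal" where
  "gabor_sum g \<Lambda> f = (\<Sum>\<^sub>\<infinity>l\<in>\<Lambda>. ennreal ((cmod (L2_inner f (tf_shift l g)))\<^sup>2))"

definition lower_frame_bound :: "(real \<Rightarrow> complex) \<Rightarrow> (real \<times> real) set \<Rightarrow> ennreal \<Rightarrow> bool" where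
  "lower_frame_bound g \<Lambda> A \<longleftrightarrow> (\<forall>f\<in>L2. A * ennreal ((L2_norm f)\<^sup>2) \<le> gabor_sum g \<Lambda> f)"

definition upper_frame_bound :: "(real \<Rightarrow> complex) \<Rightarrow> (real \<times> real) set \<Rightarrow> ennreal \<Rightarrow> bool" where
  "upper_frame_bound g \<Lambda> B \<longleftrightarrow> (\<forall>f\<in>L2. gabor_sum g \<Lambda> f \<le> B * ennreal ((L2_norm f)\<^sup>2))"

text \<open>The supremum and infimum are attained, i.e. they are the largest lower and the smallest upper
  frame bound; see \<open>lower_frame_bound_sharp\<close> and \<open>upper_frame_bound_sharp\<close>.\<close>

definition sharp_lower_frame_bound :: "(real \<Rightarrow> complex) \<Rightarrow> (real \<times> real) set \<Rightarrow> ennreal" where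
  "sharp_lower_frame_bound g \<Lambda> = Sup {A. lower_frame_bound g \<Lambda> A}"

definition sharp_upper_frame_bound :: "(real \<Rightarrow> complex) \<Rightarrow> (real \<times> real) set \<Rightarrow> ennreal" where
  "sharp_upper_frame_bound g \<Lambda> = Inf {B. upper_frame_bound g \<Lambda> B}"

text \<open>The quotient is \<open>\<infinity>\<close> if the upper bound is positive and the lower bound is \<open>0\<close>; the junk
  value \<open>0 / 0 = 0\<close> only arises when the upper bound vanishes.\<close>

definition frame_condition_number :: "(real \<Rightarrow> complex) \<Rightarrow> (real \<times> real) set \<Rightarrow> ennreal" where
  "frame_condition_number g \<Lambda> = sharp_upper_frame_bound g \<Lambda> / sharp_lower_frame_bound g \<Lambda>"

definition rect_lattice :: "real \<Rightarrow> real \<Rightarrow> (real \<times> real) set" where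
  "rect_lattice a b = range (\<lambda>k::int. a * of_int k) \<times> range (\<lambda>l::int. b * of_int l)"

definition rect_lattices :: "real \<Rightarrow> (real \<times> real) set set" where
  "rect_lattices d = {rect_lattice a b | a b. a > 0 \<and> b > 0 \<and> inverse (a * b) = d}"

definition one_sided_exp :: "real \<Rightarrow> real \<Rightarrow> complex" where
  "one_sided_exp \<gamma> t = of_real (sqrt (2 * \<gamma>) * exp (- \<gamma> * t) * indicator {0<..} t)"

lemma lower_frame_bound_sharp: "lower_frame_bound g \<Lambda> (sharp_lower_frame_bound g \<Lambda>)"
  unfolding lower_frame_bound_def
proof
  fix f assume f: "f \<in> L2"
  have "sharp_lower_frame_bound g \<Lambda> * ennreal ((L2_norm f)\<^sup>2)
      = (SUP A\<in>{A. lower_frame_bound g \<Lambda> A}. A * ennreal ((L2_norm f)\<^sup>2))"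
    unfolding sharp_lower_frame_bound_def
    using SUP_mult_right_ennreal[where f = "\<lambda>x. x"] by simp
  also have "\<dots> \<le> gabor_sum g \<Lambda> f"
    using f by (auto intro!: SUP_least simp: lower_frame_bound_def)
  finally show "sharp_lower_frame_bound g \<Lambda> * ennreal ((L2_norm f)\<^sup>2) \<le> gabor_sum g \<Lambda> f" .
qed

lemma upper_frame_bound_sharp:
  assumes "upper_frame_bound g \<Lambda> B"
  shows "upper_frame_bound g \<Lambda> (sharp_upper_frame_bound g \<Lambda>)"
  unfolding upper_frame_bound_def
proof
  fix f assume f: "f \<in> L2"
  let ?c = "ennreal ((L2_norm f)\<^sup>2)"
  show "gabor_sum g \<Lambda> f \<le> sharp_upper_frame_bound g \<Lambda> * ?c"
  proof (cases "?c = 0")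
    case True
    then show ?thesis
      using assms f unfolding upper_frame_bound_def by (metis mult_zero_right)
  next
    case False
    have "gabor_sum g \<Lambda> f / ?c \<le> sharp_upper_frame_bound g \<Lambda>"
      unfolding sharp_upper_frame_bound_def
      using f False
      by (auto intro!: Inf_greatest
          simp: upper_frame_bound_def divide_le_posI_ennreal mult.commute zero_less_iff_neq_zero)
    then have "gabor_sum g \<Lambda> f / ?c * ?c \<le> sharp_upper_frame_bound g \<Lambda> * ?c"
      by (rule mult_right_mono) simp
    moreover have "gabor_sum g \<Lambda> f / ?c * ?c = gabor_sum g \<Lambda> f"
    proof -
      have "?c * inverse ?c = 1"
        using False by (simp add: ennreal_mult_divide_eq flip: divide_ennreal_def)
      then show ?thesis
        by (simp add: divide_ennreal_def mult.assoc mult.commute[of "inverse ?c"])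
    qed
    ultimately show ?thesis by simp
  qed
qed

end

theory Submission
  imports Defs
begin

text \<open>Write \<open>\<eta> = 1 / b\<close>, \<open>a = \<eta> / n\<close>, \<open>q = exp (- \<gamma> \<eta>)\<close> and \<open>s = \<gamma> \<eta>\<close>. Every \<open>f\<close> in \<open>L\<^sup>2\<close> has the form
\<open>f = h - q h(\<cdot> + \<eta>)\<close> with \<open>h\<close> in \<open>L\<^sup>2\<close> (lemma \<open>L2_forward_difference_surj\<close>). Against the one-sided
exponential this difference telescopes: \<open>exp (- \<gamma> t)\<close> picks up exactly the factor \<open>q\<close> under translation by
\<open>\<eta>\<close>, and the modulations \<open>exp (2 \<pi> i l t / \<eta>)\<close> have period \<open>\<eta>\<close>. Hence the coefficient of \<open>f\<close> at the
lattice point \<open>(a k, b l)\<close> is the \<open>l\<close>-th Fourier coefficient of \<open>exp (- \<gamma> (t - a k)) h(t)\<close> on the single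
period \<open>(a k, a k + \<eta>]\<close>. Parseval's identity sums over \<open>l\<close>, and summing over \<open>k\<close> gives
\<open>\<integral> W |h|\<^sup>2\<close>, where \<open>W\<close> is a geometric sum: it is \<open>a\<close>-periodic and on each cell \<open>(a k, a (k + 1)]\<close> it equals
\<open>c exp (- 2 \<gamma> (t - a k))\<close> with \<open>c = 2 \<gamma> \<eta> (1 - q\<^sup>2) / (1 - exp (- 2 \<gamma> a))\<close>.

So \<open>W\<close> lies between \<open>c exp (- 2 \<gamma> a)\<close> and \<open>c\<close>, while \<open>\<parallel>f\<parallel>\<close> lies between \<open>(1 - q) \<parallel>h\<parallel>\<close> and
\<open>(1 + q) \<parallel>h\<parallel>\<close>. The two estimates are simultaneously sharp. Let \<open>h\<close> be a long train of short pulses with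
spacing \<open>\<eta>\<close>: its position inside a cell determines \<open>W\<close>, and alternating or constant signs determine
\<open>\<parallel>f\<parallel> / \<parallel>h\<parallel>\<close>. Therefore the sharp bounds are
\<open>A = c exp (- 2 \<gamma> a) / (1 + q)\<^sup>2\<close> and \<open>B = c / (1 - q)\<^sup>2\<close>, which depend on \<open>s\<close> and \<open>n\<close> alone.

What remains is calculus in \<open>s > 0\<close>. With \<open>y = 2 s / n\<close>,
\<open>s (ln A)' = 1 + s / sinh s - y / (1 - exp (- y))\<close> is strictly decreasing,
\<open>s (ln B)' = 1 - s / sinh s - y / (exp y - 1)\<close> is strictly increasing, and
\<open>(ln (B / A))' = 2 / n - 2 / sinh s\<close>. The last expression changes sign exactly at \<open>s = arsinh n\<close>. There the
first two are both equal to \<open>1 - (y / 2) coth (y / 2) < 0\<close>; so \<open>A\<close> is already past its maximum and \<open>B\<close> has not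
yet reached its minimum.\<close>

section \<open>Trigonometric polynomials\<close>

definition expo :: "real \<Rightarrow> int \<Rightarrow> real \<Rightarrow> complex" where
  "expo \<eta> l t = cis (2 * pi * of_int l * t / \<eta>)"

lemma expo_mult: "expo \<eta> k t * expo \<eta> l t = expo \<eta> (k + l) t"
  by (simp add: expo_def cis_mult add_divide_distrib ring_distribs)

lemma cnj_expo: "cnj (expo \<eta> l t) = expo \<eta> (- l) t"
  by (simp add: expo_def cis_cnj)

lemma norm_expo [simp]: "cmod (expo \<eta> l t) = 1"
  by (simp add: expo_def)

lemma expo_0 [simp]: "expo \<eta> 0 t = 1"
  by (simp add: expo_def)

lemma continuous_expo: "continuous_on A (expo \<eta> l)"
  unfolding expo_def by (cases "\<eta> = 0") (auto intro!: continuous_intros)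

lemma borel_measurable_expo [measurable]: "expo \<eta> l \<in> borel_measurable borel"
  by (rule borel_measurable_continuous_onI[OF continuous_expo])

lemma expo_add_period:
  assumes "\<eta> \<noteq> 0"
  shows "expo \<eta> l (t + \<eta>) = expo \<eta> l t"
proof -
  have "2 * pi * of_int l * (t + \<eta>) / \<eta> = 2 * pi * of_int l * t / \<eta> + 2 * pi * of_int l"
    using assms by (simp add: field_simps)
  then have "expo \<eta> l (t + \<eta>) = expo \<eta> l t * cis (2 * pi * of_int l)"
    by (simp only: expo_def cis_mult)
  also have "cis (2 * pi * of_int l) = 1"
    by (rule cis_multiple_2pi) simp
  finally show ?thesis by simp
qed

text \<open>The linear span of the characters. Building it up term by term makes closure under multiplication, which is what
the Stone--Weierstrass theorem needs, a plain induction.\<close>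

inductive trig_poly :: "real \<Rightarrow> (real \<Rightarrow> complex) \<Rightarrow> bool" for \<eta> where
  expo: "trig_poly \<eta> (\<lambda>t. c * expo \<eta> l t)"
| add: "trig_poly \<eta> p \<Longrightarrow> trig_poly \<eta> r \<Longrightarrow> trig_poly \<eta> (\<lambda>t. p t + r t)"

lemma trig_poly_const: "trig_poly \<eta> (\<lambda>t. c)"
  using trig_poly.expo[of \<eta> c 0] by simp

lemma trig_poly_mult_expo:
  assumes "trig_poly \<eta> p"
  shows "trig_poly \<eta> (\<lambda>t. p t * (c * expo \<eta> l t))"
  using assms
proof induction
  case (expo d k)
  have "(\<lambda>t. d * expo \<eta> k t * (c * expo \<eta> l t)) = (\<lambda>t. (d * c) * expo \<eta> (k + l) t)"
    by (simp add: expo_mult[symmetric] mult.assoc mult.left_commute)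
  then show ?case by (simp add: trig_poly.expo)
next
  case (add p r)
  then show ?case by (simp add: distrib_right trig_poly.add)
qed

lemma trig_poly_mult:
  assumes "trig_poly \<eta> p" "trig_poly \<eta> r"
  shows "trig_poly \<eta> (\<lambda>t. p t * r t)"
  using assms(2)
proof induction
  case (expo d k)
  then show ?case by (rule trig_poly_mult_expo[OF assms(1)])
next
  case (add r s)
  then show ?case by (simp add: distrib_left trig_poly.add)
qed

lemma trig_poly_sum:
  assumes "trig_poly \<eta> p"
  obtains K C where "finite K" "p = (\<lambda>t. \<Sum>l\<in>K. C l * expo \<eta> l t)"
proof -
  have "\<exists>K C. finite K \<and> p = (\<lambda>t. \<Sum>l\<in>K. C l * expo \<eta> l t)"
    using assms
  proof induction
    case (expo c l)
    show ?case by (rule exI[of _ "{l}"], rule exI[of _ "\<lambda>_. c"]) simp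
  next
    case (add p r)
    then obtain K C L D where
      "finite K" and p: "p = (\<lambda>t. \<Sum>l\<in>K. C l * expo \<eta> l t)" and
      "finite L" and r: "r = (\<lambda>t. \<Sum>l\<in>L. D l * expo \<eta> l t)" by blast
    let ?E = "\<lambda>l. (if l \<in> K then C l else 0) + (if l \<in> L then D l else 0)"
    have "p t = (\<Sum>l\<in>K \<union> L. (if l \<in> K then C l else 0) * expo \<eta> l t)" for t
      unfolding p using \<open>finite K\<close> \<open>finite L\<close> by (intro sum.mono_neutral_cong_left) auto
    moreover have "r t = (\<Sum>l\<in>K \<union> L. (if l \<in> L then D l else 0) * expo \<eta> l t)" for t
      unfolding r using \<open>finite K\<close> \<open>finite L\<close> by (intro sum.mono_neutral_cong_left) auto
    ultimately have "(\<lambda>t. p t + r t) = (\<lambda>t. \<Sum>l\<in>K \<union> L. ?E l * expo \<eta> l t)"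
      by (simp add: distrib_right sum.distrib)
    with \<open>finite K\<close> \<open>finite L\<close> show ?case
      by (intro exI[of _ "K \<union> L"] exI[of _ ?E]) simp
  qed
  with that show ?thesis by blast
qed

text \<open>A real polynomial in \<open>Re z\<close> and \<open>Im z\<close> is a polynomial in \<open>z\<close> and its conjugate, and on the
unit circle these are the characters of index \<open>1\<close> and \<open>-1\<close>. This transfers the Stone--Weierstrass theorem on the circle to
trigonometric polynomials.\<close>

lemma polynomial_on_circle_is_trig_poly:
  fixes P :: "complex \<Rightarrow> real"
  assumes "real_polynomial_function P"
  shows "trig_poly \<eta> (\<lambda>t. of_real (P (expo \<eta> 1 t)))"
  using assms
proof induction
  case (linear f)
  interpret bounded_linear f by fact
  let ?c = "(of_real (f 1) - \<i> * of_real (f \<i>)) / 2 :: complex"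
  let ?d = "(of_real (f 1) + \<i> * of_real (f \<i>)) / 2 :: complex"
  have "of_real (f z) = ?c * z + ?d * cnj z" for z
  proof -
    have "f z = f (Re z *\<^sub>R 1 + Im z *\<^sub>R \<i>)"
      by (rule arg_cong[of _ _ f]) (simp add: complex_eq_iff)
    also have "\<dots> = Re z * f 1 + Im z * f \<i>"
      by (simp only: add scaleR) simp
    finally show ?thesis
      by (simp add: complex_eq_iff field_simps)
  qed
  then have "(\<lambda>t. of_real (f (expo \<eta> 1 t))) = (\<lambda>t. ?c * expo \<eta> 1 t + ?d * expo \<eta> (- 1) t)"
    by (metis cnj_expo)
  moreover have "trig_poly \<eta> (\<lambda>t. ?c * expo \<eta> 1 t + ?d * expo \<eta> (- 1) t)"
    by (intro trig_poly.intros)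
  ultimately show ?case
    by (simp only:)
next
  case (const c)
  show ?case by (rule trig_poly_const)
next
  case (add f g)
  then show ?case by (simp add: trig_poly.add)
next
  case (mult f g)
  then show ?case by (simp add: trig_poly_mult)
qed

text \<open>The first character parametrizes the circle injectively except that it glues the two end points of the period.\<close>

lemma expo_1_eq_imp:
  assumes "\<eta> > 0" "s \<in> {c..c + \<eta>}" "t \<in> {c..c + \<eta>}" "expo \<eta> 1 s = expo \<eta> 1 t"
  shows "s = t \<or> s = c \<and> t = c + \<eta> \<or> s = c + \<eta> \<and> t = c"
proof -
  have "exp (\<i> * complex_of_real (2 * pi * s / \<eta>)) = exp (\<i> * complex_of_real (2 * pi * t / \<eta>))"
    using assms(4) by (simp add: expo_def cis_conv_exp)
  then obtain m :: int where
    "\<i> * complex_of_real (2 * pi * s / \<eta>) = \<i> * complex_of_real (2 * pi * t / \<eta>) + of_int (2 * m) * (of_real pi * \<i>)"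
    by (auto simp: exp_eq mult_ac)
  then have "2 * pi * s / \<eta> = 2 * pi * t / \<eta> + 2 * of_int m * pi"
    by (simp add: complex_eq_iff)
  then have "2 * pi * (s - t) = 2 * pi * (of_int m * \<eta>)"
    using assms(1) by (simp add: field_simps)
  then have m: "s - t = of_int m * \<eta>"
    using pi_neq_zero mult_left_cancel[of "2 * pi" "s - t" "of_int m * \<eta>"] by simp
  have "\<bar>s - t\<bar> \<le> \<eta>" using assms(2,3) by auto
  then have "\<bar>of_int m\<bar> * \<eta> \<le> 1 * \<eta>"
    using assms(1) by (simp add: m abs_mult)
  then have "\<bar>real_of_int m\<bar> \<le> 1"
    using assms(1) mult_le_cancel_right_pos by blast
  then have "m = -1 \<or> m = 0 \<or> m = 1" by linarith
  then show ?thesis using m assms(2,3) by auto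
qed

text \<open>A continuous function with equal values at the end points factors through the first character, because that map is a
quotient map from the compact period onto the circle. The factor is continuous on the circle and the Stone--Weierstrass
theorem approximates its real and imaginary parts.\<close>

lemma trig_poly_dense_continuous:
  fixes \<psi> :: "real \<Rightarrow> complex"
  assumes "\<eta> > 0" "continuous_on {c..c + \<eta>} \<psi>" "\<psi> c = \<psi> (c + \<eta>)" "\<epsilon> > 0"
  obtains p where "trig_poly \<eta> p" "\<And>t. t \<in> {c..c + \<eta>} \<Longrightarrow> cmod (\<psi> t - p t) < \<epsilon>"
proof -
  let ?I = "{c..c + \<eta>}"
  let ?e = "expo \<eta> 1"
  let ?S = "?e ` ?I"
  define F where "F z = \<psi> (inv_into ?I ?e z)" for z
  have F: "F (?e t) = \<psi> t" if "t \<in> ?I" for t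
    using expo_1_eq_imp[OF assms(1) _ that, of "inv_into ?I ?e (?e t)"] that assms(3)
      inv_into_into[of "?e t" ?e ?I] f_inv_into_f[of "?e t" ?e ?I]
    unfolding F_def by auto
  have contF: "continuous_on ?S F"
    unfolding continuous_on_open_gen[of F ?S UNIV, simplified]
  proof (intro allI impI)
    fix U :: "complex set" assume U: "open U"
    have "?I \<inter> ?e -` (?S \<inter> F -` U) = ?I \<inter> \<psi> -` U"
    proof (rule set_eqI)
      fix t show "t \<in> ?I \<inter> ?e -` (?S \<inter> F -` U) \<longleftrightarrow> t \<in> ?I \<inter> \<psi> -` U"
        using F[of t] by (cases "t \<in> ?I") (auto simp del: atLeastAtMost_iff)
    qed
    moreover have "openin (top_of_set ?I) (?I \<inter> \<psi> -` U)"
      using assms(2) U by (rule continuous_openin_preimage_gen)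
    moreover have "openin (top_of_set ?I) (?I \<inter> ?e -` (?S \<inter> F -` U)) \<longleftrightarrow> openin (top_of_set ?S) (?S \<inter> F -` U)"
      by (rule Abstract_Topology_2.continuous_imp_quotient_map[OF continuous_expo refl]) auto
    ultimately show "openin (top_of_set ?S) (?S \<inter> F -` U)"
      by simp
  qed
  have S: "compact ?S"
    by (intro compact_continuous_image continuous_expo) simp
  have "\<epsilon> / 2 > 0" using assms(4) by simp
  obtain P where P: "real_polynomial_function P" "\<And>z. z \<in> ?S \<Longrightarrow> \<bar>Re (F z) - P z\<bar> < \<epsilon> / 2"
    using Stone_Weierstrass_real_polynomial_function[OF S continuous_on_Re[OF contF] \<open>\<epsilon> / 2 > 0\<close>] by metis
  obtain Q where Q: "real_polynomial_function Q" "\<And>z. z \<in> ?S \<Longrightarrow> \<bar>Im (F z) - Q z\<bar> < \<epsilon> / 2"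
    using Stone_Weierstrass_real_polynomial_function[OF S continuous_on_Im[OF contF] \<open>\<epsilon> / 2 > 0\<close>] by metis
  define p where "p t = complex_of_real (P (?e t)) + complex_of_real (Q (?e t)) * \<i>" for t
  have "trig_poly \<eta> p"
    unfolding p_def
    by (intro trig_poly.add trig_poly_mult trig_poly_const polynomial_on_circle_is_trig_poly P Q)
  moreover have "cmod (\<psi> t - p t) < \<epsilon>" if t: "t \<in> ?I" for t
  proof -
    have "cmod (\<psi> t - p t) \<le> \<bar>Re (\<psi> t - p t)\<bar> + \<bar>Im (\<psi> t - p t)\<bar>"
      by (rule cmod_le)
    also have "\<dots> < \<epsilon> / 2 + \<epsilon> / 2"
      using P(2)[of "?e t"] Q(2)[of "?e t"] t F[OF t] by (intro add_strict_mono) (auto simp: p_def)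
    finally show ?thesis by simp
  qed
  ultimately show ?thesis by (rule that)
qed

section \<open>Parseval's identity on an interval\<close>

abbreviation interval_measure :: "real \<Rightarrow> real \<Rightarrow> real measure" where
  "interval_measure c \<eta> \<equiv> restrict_space lborel {c..c + \<eta>}"

lemma integrable_mult_of_squares:
  fixes u v :: "'a \<Rightarrow> complex"
  assumes [measurable]: "u \<in> borel_measurable M" "v \<in> borel_measurable M"
    and "integrable M (\<lambda>t. (cmod (u t))\<^sup>2)" "integrable M (\<lambda>t. (cmod (v t))\<^sup>2)"
  shows "integrable M (\<lambda>t. u t * v t)"
proof (rule Bochner_Integration.integrable_bound)
  show "integrable M (\<lambda>t. (cmod (u t))\<^sup>2 + (cmod (v t))\<^sup>2)"
    using assms by simp
  have "x * y \<le> x\<^sup>2 + y\<^sup>2" if "x \<ge> 0" "y \<ge> 0" for x y :: real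
    using mult_nonneg_nonneg[OF that] sum_squares_bound[of x y] unfolding mult.assoc by linarith
  then show "AE t in M. norm (u t * v t) \<le> norm ((cmod (u t))\<^sup>2 + (cmod (v t))\<^sup>2)"
    by (simp add: norm_mult)
qed simp

lemma cmod_diff_square_le: "(cmod (x - y))\<^sup>2 \<le> 2 * (cmod (x - z))\<^sup>2 + 2 * (cmod (z - y))\<^sup>2"
proof -
  have "(cmod (x - y))\<^sup>2 \<le> (cmod (x - z) + cmod (z - y))\<^sup>2"
    using norm_triangle_ineq[of "x - z" "z - y"] by (intro power_mono) auto
  also have "\<dots> \<le> 2 * (cmod (x - z))\<^sup>2 + 2 * (cmod (z - y))\<^sup>2"
    using sum_squares_bound[of "cmod (x - z)" "cmod (z - y)"] by (simp add: power2_sum)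
  finally show ?thesis .
qed

lemma finite_measure_interval: "finite_measure (interval_measure c \<eta>)"
  by (rule finite_measureI) (simp add: emeasure_restrict_space space_restrict_space emeasure_lborel_Icc_eq)

lemma measurable_interval_measure [measurable (raw)]:
  "f \<in> borel_measurable borel \<Longrightarrow> f \<in> borel_measurable (interval_measure c \<eta>)"
  by (rule measurable_restrict_space1) simp

lemma integrable_interval_bounded:
  fixes f :: "real \<Rightarrow> 'b::{banach, second_countable_topology}"
  assumes "f \<in> borel_measurable (interval_measure c \<eta>)" "\<And>t. t \<in> {c..c + \<eta>} \<Longrightarrow> norm (f t) \<le> B"
  shows "integrable (interval_measure c \<eta>) f"
proof -
  interpret finite_measure "interval_measure c \<eta>" by (rule finite_measure_interval)
  show ?thesis
    by (rule integrable_const_bound[where B = B])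
      (use assms in \<open>auto intro!: AE_I2 simp: space_restrict_space\<close>)
qed

lemma integral_expo:
  assumes "\<eta> > 0"
  shows "(LINT t|interval_measure c \<eta>. expo \<eta> l t) = (if l = 0 then of_real \<eta> else 0)"
proof (cases "l = 0")
  case True
  then show ?thesis
    using assms by (simp add: space_restrict_space measure_restrict_space scaleR_conv_of_real)
next
  case False
  define w where "w = 2 * pi * of_int l / \<eta>"
  have w: "w \<noteq> 0" using False assms by (simp add: w_def)
  have expo: "expo \<eta> l t = cis (w * t)" for t
    by (simp add: expo_def w_def)
  have D: "((\<lambda>t. cis (w * t) / (\<i> * of_real w)) has_vector_derivative cis (w * t)) (at t within S)" for t S
  proof -
    have "((\<lambda>z. exp (\<i> * of_real w * z) / (\<i> * of_real w)) has_field_derivative exp (\<i> * of_real w * of_real t)) (at (of_real t))"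
      using w by (auto intro!: derivative_eq_intros)
    from has_vector_derivative_real_field[OF this, of S] show ?thesis
      by (simp add: cis_conv_exp mult_ac)
  qed
  have "(LINT t|lborel. indicator {c..c + \<eta>} t *\<^sub>R cis (w * t))
      = cis (w * (c + \<eta>)) / (\<i> * of_real w) - cis (w * c) / (\<i> * of_real w)"
    using assms by (intro integral_FTC_Icc D) (auto intro!: continuous_intros)
  also have "cis (w * (c + \<eta>)) = cis (w * c)"
    using expo_add_period[of \<eta> l c] assms by (simp add: expo)
  finally show ?thesis
    using False by (simp add: integral_restrict_space expo)
qed

text \<open>Orthogonality of the characters. Both halves of Parseval's identity come from this formula: the choice
\<open>C = coef / \<eta>\<close> yields Bessel's inequality, and completing the square in \<open>C\<close> shows that every approximation of \<open>\<phi>\<close> bounds the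
sum of the squared coefficients from below.\<close>

lemma integral_square_diff_trig_poly:
  fixes \<phi> :: "real \<Rightarrow> complex"
  assumes "\<eta> > 0" and [measurable]: "\<phi> \<in> borel_measurable (interval_measure c \<eta>)"
    and sq: "integrable (interval_measure c \<eta>) (\<lambda>t. (cmod (\<phi> t))\<^sup>2)" and "finite K"
  defines "M \<equiv> interval_measure c \<eta>"
  defines "coef \<equiv> \<lambda>l. LINT t|M. \<phi> t * cnj (expo \<eta> l t)"
  shows "(LINT t|M. (cmod (\<phi> t - (\<Sum>l\<in>K. C l * expo \<eta> l t)))\<^sup>2)
    = (LINT t|M. (cmod (\<phi> t))\<^sup>2) - (\<Sum>l\<in>K. 2 * Re (cnj (C l) * coef l) - \<eta> * (cmod (C l))\<^sup>2)"
proof -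
  let ?P = "\<lambda>t. \<Sum>l\<in>K. C l * expo \<eta> l t"
  have int_expo: "integrable M (expo \<eta> l)" for l
    unfolding M_def by (rule integrable_interval_bounded[where B = 1]) simp_all
  have [measurable]: "\<phi> \<in> borel_measurable M" unfolding M_def by fact
  have [measurable]: "expo \<eta> l \<in> borel_measurable M" for l unfolding M_def by measurable
  have int_coef: "integrable M (\<lambda>t. \<phi> t * cnj (expo \<eta> l t))" for l
    by (rule integrable_mult_of_squares)
      (use sq in \<open>auto simp: M_def cnj_expo intro!: integrable_interval_bounded[where B = 1]\<close>)
  have cross: "(\<lambda>t. \<phi> t * cnj (?P t)) = (\<lambda>t. \<Sum>l\<in>K. cnj (C l) * (\<phi> t * cnj (expo \<eta> l t)))"
    by (simp add: sum_distrib_left mult_ac)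
  have int_cross: "integrable M (\<lambda>t. \<phi> t * cnj (?P t))"
    unfolding cross using int_coef by auto
  have cross_eq: "(LINT t|M. \<phi> t * cnj (?P t)) = (\<Sum>l\<in>K. cnj (C l) * coef l)"
    unfolding cross coef_def using int_coef by (subst Bochner_Integration.integral_sum) auto
  have sqP: "(\<lambda>t. of_real ((cmod (?P t))\<^sup>2)) = (\<lambda>t. \<Sum>k\<in>K. \<Sum>l\<in>K. C k * cnj (C l) * expo \<eta> (k - l) t)"
  proof
    fix t
    have "of_real ((cmod (?P t))\<^sup>2) = ?P t * cnj (?P t)"
      by (rule complex_norm_square)
    also have "\<dots> = (\<Sum>k\<in>K. \<Sum>l\<in>K. (C k * expo \<eta> k t) * (cnj (C l) * expo \<eta> (- l) t))"
      by (simp add: sum_product cnj_expo)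
    also have "\<dots> = (\<Sum>k\<in>K. \<Sum>l\<in>K. C k * cnj (C l) * (expo \<eta> k t * expo \<eta> (- l) t))"
      by (simp add: mult_ac)
    finally show "of_real ((cmod (?P t))\<^sup>2) = (\<Sum>k\<in>K. \<Sum>l\<in>K. C k * cnj (C l) * expo \<eta> (k - l) t)"
      by (simp add: expo_mult)
  qed
  have "complex_of_real (LINT t|M. (cmod (?P t))\<^sup>2) = (LINT t|M. of_real ((cmod (?P t))\<^sup>2))"
    by (rule integral_complex_of_real[symmetric])
  also have "\<dots> = (\<Sum>k\<in>K. \<Sum>l\<in>K. C k * cnj (C l) * (LINT t|M. expo \<eta> (k - l) t))"
    unfolding sqP using int_expo by (simp add: Bochner_Integration.integral_sum)
  also have "\<dots> = (\<Sum>k\<in>K. C k * cnj (C k) * of_real \<eta>)"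
  proof (rule sum.cong[OF refl])
    fix k assume k: "k \<in> K"
    have "(\<Sum>l\<in>K. C k * cnj (C l) * (LINT t|M. expo \<eta> (k - l) t))
        = (\<Sum>l\<in>K. if l = k then C k * cnj (C k) * of_real \<eta> else 0)"
      unfolding M_def integral_expo[OF assms(1)] by (intro sum.cong) auto
    then show "(\<Sum>l\<in>K. C k * cnj (C l) * (LINT t|M. expo \<eta> (k - l) t)) = C k * cnj (C k) * of_real \<eta>"
      using k \<open>finite K\<close> by simp
  qed
  also have "\<dots> = of_real (\<Sum>k\<in>K. \<eta> * (cmod (C k))\<^sup>2)"
    by (simp add: complex_norm_square[symmetric] mult.commute del: of_real_power)
  finally have P_eq: "(LINT t|M. (cmod (?P t))\<^sup>2) = (\<Sum>k\<in>K. \<eta> * (cmod (C k))\<^sup>2)"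
    by (simp only: of_real_eq_iff)
  have int_P: "integrable M (\<lambda>t. (cmod (?P t))\<^sup>2)"
  proof -
    have "integrable M (\<lambda>t. complex_of_real ((cmod (?P t))\<^sup>2))"
      unfolding sqP using int_expo by auto
    then show ?thesis using integrable_Re by fastforce
  qed
  \<comment> \<open>The abbreviation keeps simplification from expanding the real part of the product into coordinates.\<close>
  define X where "X t = Re (\<phi> t * cnj (?P t))" for t
  have "(cmod (x - y))\<^sup>2 = (cmod x)\<^sup>2 - 2 * Re (x * cnj y) + (cmod y)\<^sup>2" for x y
    by (simp only: cmod_power2) (simp add: power2_eq_square algebra_simps)
  then have expand: "(cmod (\<phi> t - ?P t))\<^sup>2 = (cmod (\<phi> t))\<^sup>2 - 2 * X t + (cmod (?P t))\<^sup>2" for t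
    by (simp only: X_def)
  have "integrable M X"
    unfolding X_def by (rule integrable_Re[OF int_cross])
  then have "(LINT t|M. (cmod (\<phi> t - ?P t))\<^sup>2)
      = (LINT t|M. (cmod (\<phi> t))\<^sup>2) - 2 * (LINT t|M. X t) + (LINT t|M. (cmod (?P t))\<^sup>2)"
    unfolding expand using sq[folded M_def] int_P by simp
  also have "(LINT t|M. X t) = Re (\<Sum>l\<in>K. cnj (C l) * coef l)"
    by (simp only: X_def integral_Re[OF int_cross] cross_eq)
  finally show ?thesis
    unfolding P_eq by (simp only: Re_sum sum_subtractf sum_distrib_left)
qed

lemma trig_poly_continuous: "trig_poly \<eta> p \<Longrightarrow> continuous_on A p"
  by (induction rule: trig_poly.induct) (auto intro!: continuous_intros continuous_expo)

text \<open>A measurable function is almost everywhere the limit of continuous functions. Clamping these to the disc of radius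
\<open>B\<close> and multiplying by a cutoff that vanishes at the end points makes dominated convergence applicable and forces the periodic boundary values.\<close>

lemma continuous_dense_bounded:
  fixes \<phi> :: "real \<Rightarrow> complex"
  assumes "\<eta> > 0" and \<phi>: "\<phi> \<in> borel_measurable borel" and bound: "\<And>t. cmod (\<phi> t) \<le> B" and "\<epsilon> > 0"
  obtains \<psi> where "continuous_on {c..c + \<eta>} \<psi>" "\<psi> c = 0" "\<psi> (c + \<eta>) = 0"
    "(LINT t|interval_measure c \<eta>. (cmod (\<phi> t - \<psi> t))\<^sup>2) < \<epsilon>"
proof -
  let ?I = "{c..c + \<eta>}" and ?M = "interval_measure c \<eta>"
  have [measurable]: "\<phi> \<in> borel_measurable borel" by fact
  have "\<phi> measurable_on UNIV"
    by (rule lebesgue_measurable_imp_measurable_on) (simp_all add: measurable_completion)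
  then obtain N g where N: "negligible N" and g: "\<And>n. continuous_on UNIV (g n :: real \<Rightarrow> complex)"
    and lim: "\<And>t. t \<notin> N \<Longrightarrow> (\<lambda>n. g n t) \<longlonglongrightarrow> \<phi> t"
    unfolding measurable_on_def by auto
  have "B \<ge> 0" using bound[of 0] norm_ge_zero order_trans by blast
  \<comment> \<open>\<open>r\<close> retracts the plane onto the disc of radius \<open>B\<close>; the cutoffs \<open>\<kappa> n\<close> increase to \<open>1\<close> inside the interval.\<close>
  define r where "r z = of_real (B / max B (cmod z)) * z" for z :: complex
  define \<kappa> where "\<kappa> n t = min 1 (real n * ((t - c) * (c + \<eta> - t)))" for n t
  define \<psi> where "\<psi> n t = of_real (\<kappa> n t) * r (g n t)" for n t
  show ?thesis
  proof (cases "B = 0")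
    case True
    then have "\<phi> t = 0" for t using bound[of t] by simp
    then show ?thesis using \<open>\<epsilon> > 0\<close> by (intro that[of "\<lambda>_. 0"]) auto
  next
    case False
    with \<open>B \<ge> 0\<close> have B: "B > 0" by simp
    have r_cont: "continuous_on UNIV r"
      unfolding r_def using B by (auto intro!: continuous_intros)
    have r_bound: "cmod (r z) \<le> B" for z
    proof -
      have "B * cmod z \<le> B * max B (cmod z)" using B by (intro mult_left_mono) auto
      then show ?thesis using B by (simp add: r_def norm_mult norm_divide pos_divide_le_eq max_def)
    qed
    have r_id: "r z = z" if "cmod z \<le> B" for z
      using that B by (simp add: r_def max_def)
    have \<psi>_cont: "continuous_on UNIV (\<psi> n)" for n
      unfolding \<psi>_def \<kappa>_def
      by (intro continuous_intros continuous_on_compose2[OF r_cont g]) auto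
    then have [measurable]: "\<psi> n \<in> borel_measurable borel" for n
      by (rule borel_measurable_continuous_onI)
    have \<kappa>_01: "0 \<le> \<kappa> n t \<and> \<kappa> n t \<le> 1" if "t \<in> ?I" for n t
      using that by (simp add: \<kappa>_def)
    have \<psi>_bound: "cmod (\<psi> n t) \<le> B" if "t \<in> ?I" for n t
      using mult_mono[OF conjunct2[OF \<kappa>_01[OF that]] r_bound[of "g n t"], of n] \<kappa>_01[OF that, of n]
      by (simp add: \<psi>_def norm_mult)
    have \<psi>_lim: "(\<lambda>n. \<psi> n t) \<longlonglongrightarrow> \<phi> t" if "t \<notin> N" "c < t" "t < c + \<eta>" for t
    proof -
      have pos: "(t - c) * (c + \<eta> - t) > 0" using that by simp
      have "(\<lambda>n. r (g n t)) \<longlonglongrightarrow> r (\<phi> t)"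
        using r_cont lim[OF that(1)] by (intro isCont_tendsto_compose[of _ r]) (auto simp: continuous_on_eq_continuous_at)
      moreover have "eventually (\<lambda>n. \<kappa> n t = 1) sequentially"
      proof -
        obtain m where m: "1 / ((t - c) * (c + \<eta> - t)) \<le> real m"
          using real_arch_simple by blast
        have "\<kappa> n t = 1" if "n \<ge> m" for n
        proof -
          have "1 / ((t - c) * (c + \<eta> - t)) \<le> real n" using m that by linarith
          then have "1 \<le> real n * ((t - c) * (c + \<eta> - t))" using pos by (simp add: pos_divide_le_eq)
          then show ?thesis by (simp add: \<kappa>_def)
        qed
        then show ?thesis by (auto simp: eventually_sequentially)
      qed
      then have "(\<lambda>n. \<kappa> n t) \<longlonglongrightarrow> 1"
        by (rule tendsto_eventually)
      ultimately have "(\<lambda>n. \<psi> n t) \<longlonglongrightarrow> of_real 1 * r (\<phi> t)"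
        unfolding \<psi>_def by (intro tendsto_intros)
      then show ?thesis by (simp add: r_id bound)
    qed
    have AE: "AE t in lborel. t \<notin> N \<and> t \<noteq> c \<and> t \<noteq> c + \<eta>"
    proof -
      have "AE t in lebesgue. t \<notin> N"
        using N by (simp add: negligible_iff_null_sets AE_not_in)
      then have "AE t in lborel. t \<notin> N"
        by (simp add: AE_completion_iff)
      with AE_lborel_singleton[of c] AE_lborel_singleton[of "c + \<eta>"] show ?thesis by auto
    qed
    have "(\<lambda>n. LINT t|?M. (cmod (\<phi> t - \<psi> n t))\<^sup>2) \<longlonglongrightarrow> (LINT t|?M. 0)"
    proof (rule integral_dominated_convergence[where w = "\<lambda>_. (2 * B)\<^sup>2"])
      show "integrable ?M (\<lambda>_. (2 * B)\<^sup>2)"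
        by (rule integrable_interval_bounded) auto
      have "AE t in lborel. t \<in> ?I \<longrightarrow> (\<lambda>n. (cmod (\<phi> t - \<psi> n t))\<^sup>2) \<longlonglongrightarrow> 0"
        using AE
      proof eventually_elim
        case (elim t)
        show ?case
        proof
          assume "t \<in> ?I"
          then have "(\<lambda>n. \<psi> n t) \<longlonglongrightarrow> \<phi> t" using elim by (intro \<psi>_lim) auto
          then have "(\<lambda>n. (cmod (\<phi> t - \<psi> n t))\<^sup>2) \<longlonglongrightarrow> (cmod (\<phi> t - \<phi> t))\<^sup>2"
            by (intro tendsto_intros)
          then show "(\<lambda>n. (cmod (\<phi> t - \<psi> n t))\<^sup>2) \<longlonglongrightarrow> 0" by simp
        qed
      qed
      then show "AE t in ?M. (\<lambda>n. (cmod (\<phi> t - \<psi> n t))\<^sup>2) \<longlonglongrightarrow> 0"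
        by (simp add: AE_restrict_space_iff)
      show "AE t in ?M. norm ((cmod (\<phi> t - \<psi> n t))\<^sup>2) \<le> (2 * B)\<^sup>2" for n
      proof (rule AE_I2)
        fix t assume "t \<in> space ?M"
        then have "cmod (\<phi> t - \<psi> n t) \<le> 2 * B"
          using norm_triangle_ineq4[of "\<phi> t" "\<psi> n t"] bound[of t] \<psi>_bound[of t n]
          by (auto simp: space_restrict_space)
        then have "(cmod (\<phi> t - \<psi> n t))\<^sup>2 \<le> (2 * B)\<^sup>2"
          by (rule power_mono) simp
        then show "norm ((cmod (\<phi> t - \<psi> n t))\<^sup>2) \<le> (2 * B)\<^sup>2"
          by simp
      qed
    qed measurable
    then have "\<forall>\<^sub>F n in sequentially. (LINT t|?M. (cmod (\<phi> t - \<psi> n t))\<^sup>2) < \<epsilon>"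
      using \<open>\<epsilon> > 0\<close> by (intro order_tendstoD) auto
    then obtain n where "(LINT t|?M. (cmod (\<phi> t - \<psi> n t))\<^sup>2) < \<epsilon>"
      by (auto simp: eventually_sequentially)
    moreover have "\<psi> n c = 0" "\<psi> n (c + \<eta>) = 0"
      by (auto simp: \<psi>_def \<kappa>_def)
    ultimately show ?thesis
      using continuous_on_subset[OF \<psi>_cont] by (intro that[of "\<psi> n"]) auto
  qed
qed

text \<open>Three successive approximations: truncation to a bounded function, then a continuous one, then a
trigonometric polynomial.\<close>

lemma trig_poly_dense_L2:
  fixes \<phi> :: "real \<Rightarrow> complex"
  assumes "\<eta> > 0" and [measurable]: "\<phi> \<in> borel_measurable borel"
    and sq: "integrable (interval_measure c \<eta>) (\<lambda>t. (cmod (\<phi> t))\<^sup>2)" and "\<epsilon> > 0"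
  obtains p where "trig_poly \<eta> p" "(LINT t|interval_measure c \<eta>. (cmod (\<phi> t - p t))\<^sup>2) < \<epsilon>"
proof -
  let ?M = "interval_measure c \<eta>"
  define \<phi>' where "\<phi>' n t = (if cmod (\<phi> t) \<le> real n then \<phi> t else 0)" for n t
  have [measurable]: "\<phi>' n \<in> borel_measurable borel" for n
    unfolding \<phi>'_def by measurable
  have "(\<lambda>n. LINT t|?M. (cmod (\<phi> t - \<phi>' n t))\<^sup>2) \<longlonglongrightarrow> (LINT t|?M. 0)"
  proof (rule integral_dominated_convergence[where w = "\<lambda>t. (cmod (\<phi> t))\<^sup>2"])
    show "AE t in ?M. (\<lambda>n. (cmod (\<phi> t - \<phi>' n t))\<^sup>2) \<longlonglongrightarrow> 0"
    proof (rule AE_I2)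
      fix t
      obtain m where m: "cmod (\<phi> t) \<le> real m" using real_arch_simple by blast
      then have "(cmod (\<phi> t - \<phi>' n t))\<^sup>2 = 0" if "n \<ge> m" for n
        using that by (simp add: \<phi>'_def)
      then show "(\<lambda>n. (cmod (\<phi> t - \<phi>' n t))\<^sup>2) \<longlonglongrightarrow> 0"
        by (intro tendsto_eventually) (auto simp: eventually_sequentially)
    qed
    show "AE t in ?M. norm ((cmod (\<phi> t - \<phi>' n t))\<^sup>2) \<le> (cmod (\<phi> t))\<^sup>2" for n
      by (simp add: \<phi>'_def)
  qed (use sq in measurable)
  moreover have "\<epsilon> / 16 > 0" using \<open>\<epsilon> > 0\<close> by simp
  ultimately have "\<forall>\<^sub>F n in sequentially. (LINT t|?M. (cmod (\<phi> t - \<phi>' n t))\<^sup>2) < \<epsilon> / 16"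
    by (intro order_tendstoD) auto
  then obtain n where n: "(LINT t|?M. (cmod (\<phi> t - \<phi>' n t))\<^sup>2) < \<epsilon> / 16"
    by (auto simp: eventually_sequentially)
  have \<phi>'_meas: "\<phi>' n \<in> borel_measurable borel" by measurable
  have \<phi>'_bound: "cmod (\<phi>' n t) \<le> real n" for t by (simp add: \<phi>'_def)
  obtain \<psi> where \<psi>: "continuous_on {c..c + \<eta>} \<psi>" "\<psi> c = 0" "\<psi> (c + \<eta>) = 0"
    and \<psi>_close: "(LINT t|?M. (cmod (\<phi>' n t - \<psi> t))\<^sup>2) < \<epsilon> / 16"
    by (rule continuous_dense_bounded[OF \<open>\<eta> > 0\<close> \<phi>'_meas \<phi>'_bound \<open>\<epsilon> / 16 > 0\<close>])
  define \<delta> where "\<delta> = sqrt (\<epsilon> / (4 * \<eta>))"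
  have \<delta>: "\<delta> > 0" "\<delta>\<^sup>2 * \<eta> = \<epsilon> / 4"
    using \<open>\<epsilon> > 0\<close> \<open>\<eta> > 0\<close> by (auto simp: \<delta>_def)
  obtain p where p: "trig_poly \<eta> p" and p_close: "\<And>t. t \<in> {c..c + \<eta>} \<Longrightarrow> cmod (\<psi> t - p t) < \<delta>"
    using trig_poly_dense_continuous[OF \<open>\<eta> > 0\<close> \<psi>(1) _ \<delta>(1)] \<psi>(2,3) by auto
  have [measurable]: "p \<in> borel_measurable borel"
    by (rule borel_measurable_continuous_onI[OF trig_poly_continuous[OF p]])
  have [measurable]: "\<psi> \<in> borel_measurable ?M"
    using borel_measurable_continuous_on_restrict[OF \<psi>(1)]
    by (simp add: measurable_def sets_restrict_space space_restrict_space)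
  have "bounded (\<psi> ` {c..c + \<eta>})"
    by (intro compact_imp_bounded compact_continuous_image \<psi>) simp
  then obtain B where B: "\<And>t. t \<in> {c..c + \<eta>} \<Longrightarrow> cmod (\<psi> t) \<le> B"
    unfolding bounded_iff by blast
  have int1: "integrable ?M (\<lambda>t. (cmod (\<phi> t - \<phi>' n t))\<^sup>2)"
    by (rule Bochner_Integration.integrable_bound[OF sq]) (auto simp: \<phi>'_def)
  have int2: "integrable ?M (\<lambda>t. (cmod (\<phi>' n t - \<psi> t))\<^sup>2)"
  proof (rule integrable_interval_bounded[where B = "(real n + B)\<^sup>2"])
    fix t assume t: "t \<in> {c..c + \<eta>}"
    have "cmod (\<phi>' n t - \<psi> t) \<le> real n + B"
      using norm_triangle_ineq4[of "\<phi>' n t" "\<psi> t"] \<phi>'_bound[of t] B[OF t] by linarith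
    then show "norm ((cmod (\<phi>' n t - \<psi> t))\<^sup>2) \<le> (real n + B)\<^sup>2"
      by (simp add: power_mono)
  qed measurable
  have int_const: "integrable ?M (\<lambda>_. x)" for x :: real
    by (rule integrable_interval_bounded) auto
  have le: "(cmod (\<phi> t - p t))\<^sup>2 \<le> 4 * (cmod (\<phi> t - \<phi>' n t))\<^sup>2 + 4 * (cmod (\<phi>' n t - \<psi> t))\<^sup>2 + 2 * \<delta>\<^sup>2"
    if "t \<in> {c..c + \<eta>}" for t
  proof -
    have "(cmod (\<psi> t - p t))\<^sup>2 \<le> \<delta>\<^sup>2"
      using p_close[OF that] by (intro power_mono) auto
    then show ?thesis
      using cmod_diff_square_le[of "\<phi> t" "p t" "\<psi> t"] cmod_diff_square_le[of "\<phi> t" "\<psi> t" "\<phi>' n t"] by linarith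
  qed
  have "(LINT t|?M. (cmod (\<phi> t - p t))\<^sup>2)
      \<le> (LINT t|?M. 4 * (cmod (\<phi> t - \<phi>' n t))\<^sup>2 + 4 * (cmod (\<phi>' n t - \<psi> t))\<^sup>2 + 2 * \<delta>\<^sup>2)"
  proof (rule integral_mono')
    show "integrable ?M (\<lambda>t. 4 * (cmod (\<phi> t - \<phi>' n t))\<^sup>2 + 4 * (cmod (\<phi>' n t - \<psi> t))\<^sup>2 + 2 * \<delta>\<^sup>2)"
      using int1 int2 int_const by auto
  qed (use le in \<open>auto simp: space_restrict_space\<close>)
  also have "\<dots> = 4 * (LINT t|?M. (cmod (\<phi> t - \<phi>' n t))\<^sup>2) + 4 * (LINT t|?M. (cmod (\<phi>' n t - \<psi> t))\<^sup>2) + 2 * (\<delta>\<^sup>2 * \<eta>)"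
    using int1 int2 int_const \<open>\<eta> > 0\<close> by (simp add: measure_restrict_space space_restrict_space)
  also have "\<dots> < \<epsilon>"
    using n \<psi>_close \<delta>(2) by simp
  finally show ?thesis using p by (intro that)
qed

text \<open>Bessel's inequality gives one direction and the density of trigonometric polynomials the other. Stating the sum in
\<open>[0, \<infinity>]\<close> matches the form in which the Gabor sum is given.\<close>

theorem parseval:
  fixes \<phi> :: "real \<Rightarrow> complex"
  assumes "\<eta> > 0" and [measurable]: "\<phi> \<in> borel_measurable borel"
    and sq: "integrable (interval_measure c \<eta>) (\<lambda>t. (cmod (\<phi> t))\<^sup>2)"
  shows "(\<Sum>\<^sub>\<infinity>l. ennreal ((cmod (LINT t|interval_measure c \<eta>. \<phi> t * cnj (expo \<eta> l t)))\<^sup>2))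
    = ennreal (\<eta> * (LINT t|interval_measure c \<eta>. (cmod (\<phi> t))\<^sup>2))"
proof -
  let ?M = "interval_measure c \<eta>"
  define coef where "coef l = (LINT t|?M. \<phi> t * cnj (expo \<eta> l t))" for l
  define E where "E = (LINT t|?M. (cmod (\<phi> t))\<^sup>2)"
  have dist: "(LINT t|?M. (cmod (\<phi> t - (\<Sum>l\<in>K. C l * expo \<eta> l t)))\<^sup>2)
    = E - (\<Sum>l\<in>K. 2 * Re (cnj (C l) * coef l) - \<eta> * (cmod (C l))\<^sup>2)" if "finite K" for K C
    unfolding E_def coef_def using integral_square_diff_trig_poly[OF assms(1) _ sq that, of C] by simp
  have bessel: "(\<Sum>l\<in>K. (cmod (coef l))\<^sup>2) \<le> \<eta> * E" if "finite K" for K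
  proof -
    let ?C = "\<lambda>l. coef l / of_real \<eta>"
    have "2 * Re (cnj (?C l) * coef l) - \<eta> * (cmod (?C l))\<^sup>2 = (cmod (coef l))\<^sup>2 / \<eta>" for l
      using \<open>\<eta> > 0\<close> by (simp add: norm_divide cmod_power2 power_divide) (simp add: field_simps power2_eq_square)
    then have "(LINT t|?M. (cmod (\<phi> t - (\<Sum>l\<in>K. ?C l * expo \<eta> l t)))\<^sup>2) = E - (\<Sum>l\<in>K. (cmod (coef l))\<^sup>2 / \<eta>)"
      by (simp only: dist[OF that, of ?C])
    moreover have "0 \<le> (LINT t|?M. (cmod (\<phi> t - (\<Sum>l\<in>K. ?C l * expo \<eta> l t)))\<^sup>2)"
      by (rule Bochner_Integration.integral_nonneg) simp
    ultimately have "0 \<le> E - (\<Sum>l\<in>K. (cmod (coef l))\<^sup>2 / \<eta>)"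
      by simp
    then show ?thesis
      using \<open>\<eta> > 0\<close> by (simp add: sum_divide_distrib[symmetric] field_simps)
  qed
  have complete: "\<exists>K. finite K \<and> \<eta> * E - \<eta> * \<epsilon> \<le> (\<Sum>l\<in>K. (cmod (coef l))\<^sup>2)" if eps: "\<epsilon> > 0" for \<epsilon>
  proof -
    obtain p where p: "trig_poly \<eta> p" "(LINT t|?M. (cmod (\<phi> t - p t))\<^sup>2) < \<epsilon>"
      using trig_poly_dense_L2[OF assms eps] .
    obtain K C where K: "finite K" and pK: "p = (\<lambda>t. \<Sum>l\<in>K. C l * expo \<eta> l t)"
      using trig_poly_sum[OF p(1)] .
    have le: "\<eta> * (2 * Re (cnj (C l) * coef l) - \<eta> * (cmod (C l))\<^sup>2) \<le> (cmod (coef l))\<^sup>2" for l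
    proof -
      have "(cmod (coef l))\<^sup>2 - \<eta> * (2 * Re (cnj (C l) * coef l) - \<eta> * (cmod (C l))\<^sup>2)
          = (cmod (coef l - of_real \<eta> * C l))\<^sup>2"
        by (simp only: cmod_power2) (simp add: power2_eq_square algebra_simps)
      then show ?thesis using zero_le_power2[of "cmod (coef l - of_real \<eta> * C l)"] by linarith
    qed
    have "E - (\<Sum>l\<in>K. 2 * Re (cnj (C l) * coef l) - \<eta> * (cmod (C l))\<^sup>2) < \<epsilon>"
      using dist[OF K, of C] p(2) by (simp add: pK)
    then have "\<eta> * (E - \<epsilon>) \<le> \<eta> * (\<Sum>l\<in>K. 2 * Re (cnj (C l) * coef l) - \<eta> * (cmod (C l))\<^sup>2)"
      using \<open>\<eta> > 0\<close> by (intro mult_left_mono) auto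
    also have "\<dots> \<le> (\<Sum>l\<in>K. (cmod (coef l))\<^sup>2)"
      unfolding sum_distrib_left by (rule sum_mono[OF le])
    finally show ?thesis using K by (auto simp: right_diff_distrib)
  qed
  have E0: "E \<ge> 0" unfolding E_def by simp
  have "(\<Sum>\<^sub>\<infinity>l. ennreal ((cmod (coef l))\<^sup>2)) = (SUP K\<in>{K. finite K \<and> K \<subseteq> UNIV}. \<Sum>l\<in>K. ennreal ((cmod (coef l))\<^sup>2))"
    by (rule nonneg_infsum_complete) simp
  also have "\<dots> = ennreal (\<eta> * E)"
  proof (rule antisym)
    show "(SUP K\<in>{K. finite K \<and> K \<subseteq> UNIV}. \<Sum>l\<in>K. ennreal ((cmod (coef l))\<^sup>2)) \<le> ennreal (\<eta> * E)"
      by (rule SUP_least) (auto simp: ennreal_leI bessel)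
    show "ennreal (\<eta> * E) \<le> (SUP K\<in>{K. finite K \<and> K \<subseteq> UNIV}. \<Sum>l\<in>K. ennreal ((cmod (coef l))\<^sup>2))"
    proof (rule ennreal_le_epsilon)
      fix \<epsilon> :: real assume "\<epsilon> > 0"
      then obtain K where K: "finite K" "\<eta> * E - \<epsilon> \<le> (\<Sum>l\<in>K. (cmod (coef l))\<^sup>2)"
        using complete[of "\<epsilon> / \<eta>"] \<open>\<eta> > 0\<close> by auto
      have "ennreal (\<eta> * E) \<le> ennreal ((\<Sum>l\<in>K. (cmod (coef l))\<^sup>2) + \<epsilon>)"
        using K by (intro ennreal_leI) simp
      also have "\<dots> = (\<Sum>l\<in>K. ennreal ((cmod (coef l))\<^sup>2)) + ennreal \<epsilon>"
        using \<open>\<epsilon> > 0\<close> by (simp add: ennreal_plus sum_nonneg)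
      also have "\<dots> \<le> (SUP K\<in>{K. finite K \<and> K \<subseteq> UNIV}. \<Sum>l\<in>K. ennreal ((cmod (coef l))\<^sup>2)) + ennreal \<epsilon>"
        using K(1) by (intro add_right_mono SUP_upper) auto
      finally show "ennreal (\<eta> * E) \<le> (SUP K\<in>{K. finite K \<and> K \<subseteq> UNIV}. \<Sum>l\<in>K. ennreal ((cmod (coef l))\<^sup>2)) + ennreal \<epsilon>" .
    qed
  qed
  finally show ?thesis by (simp only: E_def coef_def)
qed

section \<open>The Gabor sum as a weighted norm\<close>

text \<open>Unordered sums become integrals over a counting measure, so that Tonelli's theorem can exchange them with
Lebesgue integrals.\<close>

lemma infsum_ennreal_eq_nn_integral:
  fixes f :: "'a \<Rightarrow> ennreal"
  assumes "countable A"
  shows "infsum f A = (\<integral>\<^sup>+x. f x \<partial>count_space A)"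
proof -
  have fin: "sum f F = (\<integral>\<^sup>+x. f x * indicator F x \<partial>count_space A)" if "finite F" "F \<subseteq> A" for F
    using that by (subst nn_integral_count_space'[of F]) auto
  define F where "F n = {x \<in> A. to_nat_on A x < n}" for n
  have finF: "finite (F n)" for n
  proof (rule finite_imageD)
    show "finite (to_nat_on A ` F n)"
      by (rule finite_subset[of _ "{..<n}"]) (auto simp: F_def)
    show "inj_on (to_nat_on A) (F n)"
      using inj_on_to_nat_on[OF assms] by (rule inj_on_subset) (auto simp: F_def)
  qed
  have subF: "F n \<subseteq> A" for n by (auto simp: F_def)
  have "infsum f A = (SUP F\<in>{F. finite F \<and> F \<subseteq> A}. sum f F)"
    by (rule nonneg_infsum_complete) simp
  also have "\<dots> = (\<integral>\<^sup>+x. f x \<partial>count_space A)"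
  proof (rule antisym)
    show "(SUP F\<in>{F. finite F \<and> F \<subseteq> A}. sum f F) \<le> (\<integral>\<^sup>+x. f x \<partial>count_space A)"
      by (rule SUP_least) (auto simp: fin intro!: nn_integral_mono split: split_indicator)
    have "(\<integral>\<^sup>+x. f x \<partial>count_space A) = (\<integral>\<^sup>+x. (SUP n. f x * indicator (F n) x) \<partial>count_space A)"
    proof (rule nn_integral_cong)
      fix x assume "x \<in> space (count_space A)"
      then have "x \<in> F (Suc (to_nat_on A x))" by (simp add: F_def)
      then have "f x \<le> (SUP n. f x * indicator (F n) x)"
        by (intro SUP_upper2[of "Suc (to_nat_on A x)"]) auto
      moreover have "(SUP n. f x * indicator (F n) x) \<le> f x"
        by (rule SUP_least) (auto split: split_indicator)
      ultimately show "f x = (SUP n. f x * indicator (F n) x)" by (rule antisym)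
    qed
    also have "\<dots> = (SUP n. \<integral>\<^sup>+x. f x * indicator (F n) x \<partial>count_space A)"
      by (rule nn_integral_monotone_convergence_SUP)
        (auto simp: incseq_def le_fun_def F_def split: split_indicator)
    also have "\<dots> \<le> (SUP F\<in>{F. finite F \<and> F \<subseteq> A}. sum f F)"
      using finF subF by (intro SUP_least) (auto simp: fin[symmetric] intro!: SUP_upper)
    finally show "(\<integral>\<^sup>+x. f x \<partial>count_space A) \<le> (SUP F\<in>{F. finite F \<and> F \<subseteq> A}. sum f F)" .
  qed
  finally show ?thesis .
qed

lemma L2_D:
  assumes "f \<in> L2"
  shows "f \<in> borel_measurable borel" "integrable lborel (\<lambda>t. (cmod (f t))\<^sup>2)"
  using assms by (auto simp: L2_def)

lemma L2_norm_square: "(L2_norm f)\<^sup>2 = (LINT t|lborel. (cmod (f t))\<^sup>2)"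
  by (simp add: L2_norm_def)

lemma L2_shift:
  assumes "f \<in> L2"
  shows "(\<lambda>t. f (t + c)) \<in> L2" "(LINT t|lborel. (cmod (f (t + c)))\<^sup>2) = (LINT t|lborel. (cmod (f t))\<^sup>2)"
proof -
  note [measurable] = L2_D(1)[OF assms]
  have "integrable lborel (\<lambda>t. (cmod (f (c + 1 * t)))\<^sup>2)"
    using lborel_integrable_real_affine[OF L2_D(2)[OF assms], of 1 c] by simp
  then show "(\<lambda>t. f (t + c)) \<in> L2"
    by (simp add: L2_def add.commute)
  show "(LINT t|lborel. (cmod (f (t + c)))\<^sup>2) = (LINT t|lborel. (cmod (f t))\<^sup>2)"
    using lborel_integral_real_affine[of 1 "\<lambda>t. (cmod (f t))\<^sup>2" c] by (simp add: add.commute)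
qed

lemma tf_shift_eq_expo: "tf_shift (x, 1 / \<eta> * of_int l) g t = g (t - x) * expo \<eta> l t"
  by (simp add: tf_shift_def expo_def cis_conv_exp mult_ac)

lemma sqrt_exp_square:
  assumes "\<gamma> > 0"
  shows "(sqrt (2 * \<gamma>) * exp (- \<gamma> * x))\<^sup>2 = 2 * \<gamma> * exp (- (2 * \<gamma>) * x)"
proof -
  have "(exp (- \<gamma> * x))\<^sup>2 = exp (- (2 * \<gamma>) * x)"
    by (simp add: power2_eq_square flip: exp_add)
  then show ?thesis using assms by (simp only: power_mult_distrib) simp
qed

lemma one_sided_exp_L2:
  assumes "\<gamma> > 0"
  shows "one_sided_exp \<gamma> \<in> L2"
proof -
  have [measurable]: "one_sided_exp \<gamma> \<in> borel_measurable borel"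
    unfolding one_sided_exp_def by measurable
  have "(\<integral>\<^sup>+t. ennreal (2 * \<gamma> * exp (- (2 * \<gamma>) * t)) * indicator {0..} t \<partial>lborel) = 0 - (- exp (- (2 * \<gamma>) * 0))"
  proof (rule nn_integral_FTC_atLeast)
    show "((\<lambda>t. - exp (- (2 * \<gamma>) * t)) has_real_derivative 2 * \<gamma> * exp (- (2 * \<gamma>) * t)) (at t)" for t
      by (auto intro!: derivative_eq_intros)
    have "((\<lambda>t. exp (- (2 * \<gamma>) * t)) \<longlongrightarrow> 0) at_top"
      using assms by (intro filterlim_compose[OF exp_at_bot] filterlim_tendsto_neg_mult_at_bot[OF tendsto_const _ filterlim_ident]) simp
    then show "((\<lambda>t. - exp (- (2 * \<gamma>) * t)) \<longlongrightarrow> 0) at_top"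
      using tendsto_minus by fastforce
  qed (use assms in auto)
  then have fin: "(\<integral>\<^sup>+t. ennreal (2 * \<gamma> * exp (- (2 * \<gamma>) * t)) * indicator {0..} t \<partial>lborel) < \<infinity>"
    by simp
  have "(\<integral>\<^sup>+t. ennreal ((cmod (one_sided_exp \<gamma> t))\<^sup>2) \<partial>lborel) \<le> (\<integral>\<^sup>+t. ennreal (2 * \<gamma> * exp (- (2 * \<gamma>) * t)) * indicator {0..} t \<partial>lborel)"
  proof (rule nn_integral_mono)
    fix t :: real
    show "ennreal ((cmod (one_sided_exp \<gamma> t))\<^sup>2) \<le> ennreal (2 * \<gamma> * exp (- (2 * \<gamma>) * t)) * indicator {0..} t"
      using sqrt_exp_square[OF assms, of t] assms
      by (auto simp: one_sided_exp_def norm_mult abs_mult split: split_indicator)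
  qed
  then have "(\<integral>\<^sup>+t. ennreal ((cmod (one_sided_exp \<gamma> t))\<^sup>2) \<partial>lborel) < \<infinity>"
    using fin by (rule le_less_trans)
  then have "integrable lborel (\<lambda>t. (cmod (one_sided_exp \<gamma> t))\<^sup>2)"
    by (intro integrableI_nonneg) auto
  then show ?thesis by (simp add: L2_def)
qed

text \<open>The key identity. Moving the translation by \<open>\<eta>\<close> from \<open>h\<close> to the atom multiplies the atom by
\<open>exp (\<gamma> \<eta>)\<close>, which the factor in front undoes, cuts off its first period, and leaves its modulation unchanged. The two half-line integrals therefore cancel
except on the first period, where the coefficient becomes a Fourier coefficient.\<close>

lemma L2_inner_tf_shift_one_sided_exp:
  assumes "\<gamma> > 0" "\<eta> > 0" "h \<in> L2" "f \<in> L2"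
    and f: "AE t in lborel. f t = h t - of_real (exp (- \<gamma> * \<eta>)) * h (t + \<eta>)"
  shows "L2_inner f (tf_shift (x, 1 / \<eta> * of_int l) (one_sided_exp \<gamma>))
    = (LINT t|interval_measure x \<eta>. of_real (sqrt (2 * \<gamma>) * exp (- \<gamma> * (t - x))) * h t * cnj (expo \<eta> l t))"
proof -
  define q where "q = exp (- \<gamma> * \<eta>)"
  define G where "G t = cnj (one_sided_exp \<gamma> (t - x) * expo \<eta> l t)" for t
  note [measurable] = L2_D(1)[OF assms(3)] L2_D(1)[OF assms(4)]
  have [measurable]: "one_sided_exp \<gamma> \<in> borel_measurable borel"
    by (rule L2_D(1)[OF one_sided_exp_L2[OF assms(1)]])
  have "G \<in> borel_measurable borel"
  proof -
    have "G = (\<lambda>t. one_sided_exp \<gamma> (t - x) * expo \<eta> (- l) t)"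
      by (simp add: G_def one_sided_exp_def cnj_expo fun_eq_iff)
    then show ?thesis by simp
  qed
  then have G_L2: "G \<in> L2"
    using L2_shift(1)[OF one_sided_exp_L2[OF assms(1)], of "- x"]
    by (auto simp: G_def L2_def norm_mult)
  note [measurable] = L2_D(1)[OF G_L2]
  have h': "(\<lambda>t. h (t + \<eta>)) \<in> L2" by (rule L2_shift(1)[OF assms(3)])
  have int1: "integrable lborel (\<lambda>t. h t * G t)" and int2: "integrable lborel (\<lambda>t. h (t + \<eta>) * G t)"
    using L2_D[OF G_L2] L2_D[OF assms(3)] L2_D[OF h'] by (auto intro!: integrable_mult_of_squares)
  have int3: "integrable lborel (\<lambda>t. h t * G (t - \<eta>))"
    using lborel_integrable_real_affine[OF int2, of 1 "- \<eta>"] by simp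
  have shift: "(LINT t|lborel. h (t + \<eta>) * G t) = (LINT t|lborel. h t * G (t - \<eta>))"
    using lborel_integral_real_affine[of 1 "\<lambda>t. h (t + \<eta>) * G t" "- \<eta>"] by simp
  have "L2_inner f (tf_shift (x, 1 / \<eta> * of_int l) (one_sided_exp \<gamma>)) = (LINT t|lborel. f t * G t)"
    by (simp only: L2_inner_def tf_shift_eq_expo G_def)
  also have "\<dots> = (LINT t|lborel. h t * G t - of_real q * (h (t + \<eta>) * G t))"
  proof (rule integral_cong_AE)
    show "AE t in lborel. f t * G t = h t * G t - of_real q * (h (t + \<eta>) * G t)"
      using f by eventually_elim (simp only: q_def left_diff_distrib mult.assoc)
  qed measurable
  also have "\<dots> = (LINT t|lborel. h t * G t) - of_real q * (LINT t|lborel. h (t + \<eta>) * G t)"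
    using int1 int2 by simp
  also have "\<dots> = (LINT t|lborel. h t * G t) - of_real q * (LINT t|lborel. h t * G (t - \<eta>))"
    unfolding shift ..
  also have "\<dots> = (LINT t|lborel. h t * G t - of_real q * (h t * G (t - \<eta>)))"
    using int1 int3 by simp
  also have "\<dots> = (LINT t|lborel. indicator {x..x + \<eta>} t *\<^sub>R
      (of_real (sqrt (2 * \<gamma>) * exp (- \<gamma> * (t - x))) * h t * cnj (expo \<eta> l t)))"
  proof (rule integral_cong_AE)
    \<comment> \<open>The window of the one-sided exponential is open on the left, the interval of integration is closed.\<close>
    have "AE t in lborel. t \<noteq> x" by (rule AE_lborel_singleton)
    then show "AE t in lborel. h t * G t - of_real q * (h t * G (t - \<eta>))
      = indicator {x..x + \<eta>} t *\<^sub>R (of_real (sqrt (2 * \<gamma>) * exp (- \<gamma> * (t - x))) * h t * cnj (expo \<eta> l t))"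
    proof eventually_elim
      case (elim t)
      have e: "expo \<eta> l (t - \<eta>) = expo \<eta> l t"
        using expo_add_period[of \<eta> l "t - \<eta>"] assms(2) by simp
      have "q * exp (- \<gamma> * (t - \<eta> - x)) = exp (- \<gamma> * (t - x))"
        by (simp add: q_def algebra_simps flip: exp_add)
      then have "of_real q * G (t - \<eta>) = of_real (sqrt (2 * \<gamma>) * exp (- \<gamma> * (t - x)) * indicator {x + \<eta><..} t) * cnj (expo \<eta> l t)"
        by (auto simp: G_def one_sided_exp_def e mult_ac split: split_indicator simp flip: of_real_mult)
      moreover have "G t = of_real (sqrt (2 * \<gamma>) * exp (- \<gamma> * (t - x)) * indicator {x<..} t) * cnj (expo \<eta> l t)"
        by (auto simp: G_def one_sided_exp_def split: split_indicator)
      moreover have "h t * G t - of_real q * (h t * G (t - \<eta>)) = h t * (G t - of_real q * G (t - \<eta>))"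
        by (simp add: algebra_simps)
      ultimately show ?case
        using elim assms(2) by (auto simp: algebra_simps split: split_indicator)
    qed
  qed (auto simp: cnj_expo)
  finally show ?thesis by (simp add: integral_restrict_space)
qed

text \<open>Parseval's identity for the sum over the modulations, Tonelli's theorem for the sum over the translations.\<close>

lemma gabor_sum_eq_weighted_norm:
  assumes "\<gamma> > 0" "\<eta> > 0" "a > 0" "h \<in> L2" "f \<in> L2"
    and f: "AE t in lborel. f t = h t - of_real (exp (- \<gamma> * \<eta>)) * h (t + \<eta>)"
  shows "gabor_sum (one_sided_exp \<gamma>) (rect_lattice a (1 / \<eta>)) f
    = (\<integral>\<^sup>+t. ennreal (2 * \<gamma> * \<eta> * (cmod (h t))\<^sup>2) *
        (\<integral>\<^sup>+k. ennreal (exp (- (2 * \<gamma>) * (t - a * of_int k))) * indicator {a * of_int k<..a * of_int k + \<eta>} t \<partial>count_space (UNIV :: int set))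
      \<partial>lborel)"
proof -
  let ?g = "one_sided_exp \<gamma>"
  let ?c = "\<lambda>k l. ennreal ((cmod (L2_inner f (tf_shift (a * of_int k, 1 / \<eta> * of_int l) ?g)))\<^sup>2)"
  let ?e = "\<lambda>(k :: int) t. exp (- (2 * \<gamma>) * (t - a * of_int k))"
  let ?I = "\<lambda>(k :: int). {a * of_int k<..a * of_int k + \<eta>}"
  note [measurable] = L2_D(1)[OF assms(4)]
  define \<iota> where "\<iota> = (\<lambda>(k :: int, l :: int). (a * of_int k, 1 / \<eta> * of_int l))"
  have "inj \<iota>" using assms(2,3) by (auto simp: \<iota>_def inj_def)
  have range: "rect_lattice a (1 / \<eta>) = range \<iota>"
    by (auto simp: rect_lattice_def \<iota>_def image_iff)
  have row: "(\<integral>\<^sup>+l. ?c k l \<partial>count_space UNIV)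
      = (\<integral>\<^sup>+t. ennreal (2 * \<gamma> * \<eta> * (cmod (h t))\<^sup>2) * (ennreal (?e k t) * indicator (?I k) t) \<partial>lborel)" for k
  proof -
    let ?x = "a * of_int k"
    let ?M = "interval_measure ?x \<eta>"
    define \<phi> where "\<phi> t = of_real (sqrt (2 * \<gamma>) * exp (- \<gamma> * (t - ?x))) * h t" for t
    have [measurable]: "\<phi> \<in> borel_measurable borel"
      unfolding \<phi>_def by measurable
    have sq_eq: "(cmod (\<phi> t))\<^sup>2 = 2 * \<gamma> * ?e k t * (cmod (h t))\<^sup>2" for t
    proof -
      have "(sqrt (2 * \<gamma>) * exp (- \<gamma> * (t - ?x)))\<^sup>2 = 2 * \<gamma> * ?e k t"
        by (rule sqrt_exp_square[OF assms(1)])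
      then show ?thesis
        by (simp add: \<phi>_def norm_mult power_mult_distrib)
    qed
    have int: "integrable ?M (\<lambda>t. (cmod (\<phi> t))\<^sup>2)"
    proof (rule Bochner_Integration.integrable_bound)
      show "integrable ?M (\<lambda>t. 2 * \<gamma> * (cmod (h t))\<^sup>2)"
        using integrable_mult_indicator[OF _ L2_D(2)[OF assms(4)], of "{?x..?x + \<eta>}"]
        by (simp add: integrable_restrict_space set_integrable_def)
      show "AE t in ?M. norm ((cmod (\<phi> t))\<^sup>2) \<le> norm (2 * \<gamma> * (cmod (h t))\<^sup>2)"
        using assms(1) unfolding sq_eq
        by (intro AE_I2) (auto simp: space_restrict_space abs_mult intro!: mult_left_le_one_le)
    qed measurable
    have "(\<integral>\<^sup>+l. ?c k l \<partial>count_space UNIV) = (\<Sum>\<^sub>\<infinity>l. ?c k l)"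
      by (rule infsum_ennreal_eq_nn_integral[symmetric]) simp
    also have "\<dots> = (\<Sum>\<^sub>\<infinity>l. ennreal ((cmod (LINT t|?M. \<phi> t * cnj (expo \<eta> l t)))\<^sup>2))"
      using L2_inner_tf_shift_one_sided_exp[OF assms(1,2,4,5) f] by (simp add: \<phi>_def)
    also have "\<dots> = ennreal (\<eta> * (LINT t|?M. (cmod (\<phi> t))\<^sup>2))"
      using parseval[OF assms(2) _ int] by simp
    also have "\<dots> = (\<integral>\<^sup>+t. ennreal (\<eta> * (cmod (\<phi> t))\<^sup>2) \<partial>?M)"
      using int assms(2) by (subst nn_integral_eq_integral) auto
    also have "\<dots> = (\<integral>\<^sup>+t. ennreal (\<eta> * (cmod (\<phi> t))\<^sup>2) * indicator {?x..?x + \<eta>} t \<partial>lborel)"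
      by (subst nn_integral_restrict_space) auto
    also have "\<dots> = (\<integral>\<^sup>+t. ennreal (2 * \<gamma> * \<eta> * (cmod (h t))\<^sup>2) * (ennreal (?e k t) * indicator (?I k) t) \<partial>lborel)"
    proof (rule nn_integral_cong_AE)
      show "AE t in lborel. ennreal (\<eta> * (cmod (\<phi> t))\<^sup>2) * indicator {?x..?x + \<eta>} t
          = ennreal (2 * \<gamma> * \<eta> * (cmod (h t))\<^sup>2) * (ennreal (?e k t) * indicator (?I k) t)"
        using AE_lborel_singleton[of ?x]
      proof eventually_elim
        case (elim t)
        have "ennreal (\<eta> * (cmod (\<phi> t))\<^sup>2) = ennreal (2 * \<gamma> * \<eta> * (cmod (h t))\<^sup>2) * ennreal (?e k t)"
          unfolding sq_eq using assms(1,2) by (subst ennreal_mult[symmetric]) (auto simp: mult_ac)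
        then show ?case using elim by (auto split: split_indicator)
      qed
    qed
    finally show ?thesis .
  qed
  have "gabor_sum ?g (rect_lattice a (1 / \<eta>)) f = infsum (\<lambda>p. ennreal ((cmod (L2_inner f (tf_shift p ?g)))\<^sup>2)) (range \<iota>)"
    by (simp only: gabor_sum_def range)
  also have "\<dots> = (\<Sum>\<^sub>\<infinity>(k, l). ?c k l)"
    by (subst infsum_reindex[OF \<open>inj \<iota>\<close>]) (auto simp: \<iota>_def o_def intro!: infsum_cong)
  also have "\<dots> = (\<integral>\<^sup>+(k, l). ?c k l \<partial>count_space UNIV)"
    by (rule infsum_ennreal_eq_nn_integral) simp
  also have "\<dots> = (\<integral>\<^sup>+k. \<integral>\<^sup>+l. ?c k l \<partial>count_space UNIV \<partial>count_space UNIV)"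
    by (subst nn_integral_fst_count_space[symmetric]) simp
  also have "\<dots> = (\<integral>\<^sup>+k. \<integral>\<^sup>+t. ennreal (2 * \<gamma> * \<eta> * (cmod (h t))\<^sup>2) * (ennreal (?e k t) * indicator (?I k) t) \<partial>lborel \<partial>count_space UNIV)"
    by (simp only: row)
  also have "\<dots> = (\<integral>\<^sup>+t. \<integral>\<^sup>+k. ennreal (2 * \<gamma> * \<eta> * (cmod (h t))\<^sup>2) * (ennreal (?e k t) * indicator (?I k) t) \<partial>count_space UNIV \<partial>lborel)"
    by (rule nn_integral_count_space_nn_integral[symmetric]) simp_all
  also have "\<dots> = (\<integral>\<^sup>+t. ennreal (2 * \<gamma> * \<eta> * (cmod (h t))\<^sup>2) * (\<integral>\<^sup>+k. ennreal (?e k t) * indicator (?I k) t \<partial>count_space UNIV) \<partial>lborel)"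
    by (simp add: nn_integral_cmult)
  finally show ?thesis .
qed

text \<open>A point of the cell with left end \<open>a k\<^sub>0\<close> lies in exactly the \<open>n\<close> windows that start at
\<open>a k\<^sub>0, a (k\<^sub>0 - 1), \<dots>, a (k\<^sub>0 - n + 1)\<close>; the weight is a geometric sum over them.\<close>

lemma weight_eq:
  fixes a t \<gamma> :: real and n :: nat and k\<^sub>0 :: int
  assumes "\<gamma> > 0" "a > 0" "n > 0" "a * of_int k\<^sub>0 < t" "t \<le> a * (of_int k\<^sub>0 + 1)"
  shows "(\<integral>\<^sup>+k. ennreal (exp (- (2 * \<gamma>) * (t - a * of_int k))) * indicator {a * of_int k<..a * of_int k + n * a} t \<partial>count_space (UNIV :: int set))
    = ennreal (exp (- (2 * \<gamma>) * (t - a * of_int k\<^sub>0)) * ((1 - exp (- (2 * \<gamma> * (n * a)))) / (1 - exp (- (2 * \<gamma> * a)))))"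
proof -
  let ?e = "\<lambda>k. exp (- (2 * \<gamma>) * (t - a * of_int k))"
  let ?\<kappa> = "\<lambda>j. k\<^sub>0 - int j"
  have ind: "t \<in> {a * of_int k<..a * of_int k + n * a} \<longleftrightarrow> k \<in> ?\<kappa> ` {..<n}" for k
  proof
    assume "t \<in> {a * of_int k<..a * of_int k + n * a}"
    then have k: "a * of_int k < t" "t \<le> a * (of_int k + real n)" by (auto simp: algebra_simps)
    have "a * of_int k < a * (of_int k\<^sub>0 + 1)" using k(1) assms(5) by linarith
    then have "k \<le> k\<^sub>0" using assms(2) by simp
    moreover have "a * of_int k\<^sub>0 < a * (of_int k + real n)" using k(2) assms(4) by linarith
    then have "k\<^sub>0 < k + int n" using assms(2) by simp
    ultimately show "k \<in> ?\<kappa> ` {..<n}"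
      by (intro image_eqI[of _ _ "nat (k\<^sub>0 - k)"]) auto
  next
    assume "k \<in> ?\<kappa> ` {..<n}"
    then obtain j where j: "j < n" "k = k\<^sub>0 - int j" by auto
    have "a * of_int k \<le> a * of_int k\<^sub>0"
      using j assms(2) by (intro mult_left_mono) auto
    then have lower: "a * of_int k < t" using assms(4) by linarith
    have "a * (of_int k\<^sub>0 + 1) \<le> a * (of_int k + real n)"
      using j assms(2) by (intro mult_left_mono) auto
    also have "\<dots> = a * of_int k + n * a" by (simp add: algebra_simps)
    finally show "t \<in> {a * of_int k<..a * of_int k + n * a}"
      using lower assms(5) by simp
  qed
  have "(\<integral>\<^sup>+k. ennreal (?e k) * indicator {a * of_int k<..a * of_int k + n * a} t \<partial>count_space (UNIV :: int set))
      = (\<Sum>k\<in>?\<kappa> ` {..<n}. ennreal (?e k) * indicator {a * of_int k<..a * of_int k + n * a} t)"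
    using ind by (intro nn_integral_count_space') (auto simp: indicator_def)
  also have "\<dots> = (\<Sum>k\<in>?\<kappa> ` {..<n}. ennreal (?e k))"
    using ind by (intro sum.cong) (auto simp: indicator_def)
  also have "\<dots> = (\<Sum>j<n. ennreal (?e (?\<kappa> j)))"
    by (subst sum.reindex) (auto simp: inj_on_def)
  also have "\<dots> = ennreal (\<Sum>j<n. ?e (?\<kappa> j))"
    by (rule sum_ennreal) simp
  also have "(\<Sum>j<n. ?e (?\<kappa> j)) = (\<Sum>j<n. ?e k\<^sub>0 * exp (- (2 * \<gamma> * a)) ^ j)"
    by (intro sum.cong) (auto simp: algebra_simps simp flip: exp_add exp_of_nat_mult)
  also have "\<dots> = ?e k\<^sub>0 * ((1 - exp (- (2 * \<gamma> * a)) ^ n) / (1 - exp (- (2 * \<gamma> * a))))"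
    using assms(1,2) by (simp add: sum_distrib_left[symmetric] sum_gp_strict)
  also have "exp (- (2 * \<gamma> * a)) ^ n = exp (- (2 * \<gamma> * (n * a)))"
    by (simp add: mult_ac flip: exp_of_nat_mult)
  finally show ?thesis .
qed

lemma lattice_cell:
  fixes a t :: real
  assumes "a > 0"
  obtains k :: int where "a * of_int k < t" "t \<le> a * (of_int k + 1)"
proof
  have "of_int (\<lceil>t / a\<rceil> - 1) < t / a" by linarith
  then show "a * of_int (\<lceil>t / a\<rceil> - 1) < t"
    using assms by (simp add: pos_less_divide_eq mult.commute)
  have "a * (t / a) \<le> a * of_int \<lceil>t / a\<rceil>"
    using assms by (intro mult_left_mono) auto
  then show "t \<le> a * (of_int (\<lceil>t / a\<rceil> - 1) + 1)"
    using assms by simp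
qed

text \<open>On a cell the weight depends only on the offset from its left end. The support condition confines this offset to
\<open>[u, v]\<close>: the choice \<open>u = 0\<close>, \<open>v = \<eta> / n\<close> holds for every \<open>h\<close> and yields the frame bounds, while a short interval makes the
estimate nearly an equality and yields their sharpness.\<close>

lemma gabor_sum_bounds:
  fixes \<gamma> \<eta> :: real and n :: nat
  assumes "\<gamma> > 0" "\<eta> > 0" "n > 0" "h \<in> L2" "f \<in> L2"
    and f: "AE t in lborel. f t = h t - of_real (exp (- \<gamma> * \<eta>)) * h (t + \<eta>)"
    and supp: "\<forall>t. h t \<noteq> 0 \<longrightarrow>
      (\<exists>k :: int. \<eta> / n * of_int k < t \<and> t \<le> \<eta> / n * (of_int k + 1) \<and> u \<le> t - \<eta> / n * of_int k \<and> t - \<eta> / n * of_int k \<le> v)"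
  defines "c \<equiv> 2 * \<gamma> * \<eta> * ((1 - exp (- (2 * \<gamma> * \<eta>))) / (1 - exp (- (2 * \<gamma> * (\<eta> / n)))))"
  shows "ennreal (c * exp (- (2 * \<gamma>) * v) * (LINT t|lborel. (cmod (h t))\<^sup>2))
      \<le> gabor_sum (one_sided_exp \<gamma>) (rect_lattice (\<eta> / n) (1 / \<eta>)) f" (is ?lower)
    and "gabor_sum (one_sided_exp \<gamma>) (rect_lattice (\<eta> / n) (1 / \<eta>)) f
      \<le> ennreal (c * exp (- (2 * \<gamma>) * u) * (LINT t|lborel. (cmod (h t))\<^sup>2))" (is ?upper)
proof -
  let ?a = "\<eta> / n"
  let ?W = "\<lambda>t. \<integral>\<^sup>+k. ennreal (exp (- (2 * \<gamma>) * (t - ?a * of_int k))) * indicator {?a * of_int k<..?a * of_int k + \<eta>} t \<partial>count_space (UNIV :: int set)"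
  note [measurable] = L2_D(1)[OF assms(4)]
  have a: "?a > 0" "real n * ?a = \<eta>" using assms(2,3) by auto
  have c: "c > 0"
    unfolding c_def using assms(1-3) by (intro mult_pos_pos divide_pos_pos) auto
  have bounds: "ennreal (c * exp (- (2 * \<gamma>) * v) * (cmod (h t))\<^sup>2) \<le> ennreal (2 * \<gamma> * \<eta> * (cmod (h t))\<^sup>2) * ?W t"
    "ennreal (2 * \<gamma> * \<eta> * (cmod (h t))\<^sup>2) * ?W t \<le> ennreal (c * exp (- (2 * \<gamma>) * u) * (cmod (h t))\<^sup>2)" for t
  proof -
    have "ennreal (c * exp (- (2 * \<gamma>) * v) * (cmod (h t))\<^sup>2) \<le> ennreal (2 * \<gamma> * \<eta> * (cmod (h t))\<^sup>2) * ?W t \<and>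
      ennreal (2 * \<gamma> * \<eta> * (cmod (h t))\<^sup>2) * ?W t \<le> ennreal (c * exp (- (2 * \<gamma>) * u) * (cmod (h t))\<^sup>2)"
      if ht: "h t \<noteq> 0"
    proof -
      obtain k :: int where k: "?a * of_int k < t" "t \<le> ?a * (of_int k + 1)"
        "u \<le> t - ?a * of_int k" "t - ?a * of_int k \<le> v"
        using supp ht by blast
      have "ennreal (2 * \<gamma> * \<eta> * (cmod (h t))\<^sup>2) * ?W t
          = ennreal (c * exp (- (2 * \<gamma>) * (t - ?a * of_int k)) * (cmod (h t))\<^sup>2)"
        using weight_eq[OF assms(1) a(1) assms(3) k(1,2)] assms(1-3) unfolding a(2)
        by (simp only:) (subst ennreal_mult[symmetric], auto simp: c_def mult_ac intro!: mult_nonneg_nonneg divide_nonneg_nonneg)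
      moreover have "exp (- (2 * \<gamma>) * v) \<le> exp (- (2 * \<gamma>) * (t - ?a * of_int k))"
        "exp (- (2 * \<gamma>) * (t - ?a * of_int k)) \<le> exp (- (2 * \<gamma>) * u)"
        using k(3,4) assms(1) by auto
      ultimately show ?thesis
        using c by (auto intro!: ennreal_leI mult_right_mono mult_left_mono)
    qed
    then show "ennreal (c * exp (- (2 * \<gamma>) * v) * (cmod (h t))\<^sup>2) \<le> ennreal (2 * \<gamma> * \<eta> * (cmod (h t))\<^sup>2) * ?W t"
      "ennreal (2 * \<gamma> * \<eta> * (cmod (h t))\<^sup>2) * ?W t \<le> ennreal (c * exp (- (2 * \<gamma>) * u) * (cmod (h t))\<^sup>2)"
      by (cases "h t = 0"; simp)+
  qed
  have int: "(\<integral>\<^sup>+t. ennreal (c * exp (- (2 * \<gamma>) * r) * (cmod (h t))\<^sup>2) \<partial>lborel)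
      = ennreal (c * exp (- (2 * \<gamma>) * r) * (LINT t|lborel. (cmod (h t))\<^sup>2))" for r
    using L2_D(2)[OF assms(4)] c by (subst nn_integral_eq_integral) auto
  note gabor_sum_eq_weighted_norm[OF assms(1,2) a(1) assms(4,5) f]
  note sum_eq = this
  show ?lower
    unfolding sum_eq int[symmetric] by (intro nn_integral_mono bounds)
  show ?upper
    unfolding sum_eq int[symmetric] by (intro nn_integral_mono bounds)
qed

section \<open>Inverting the one-sided difference\<close>

lemma cmod_weighted_sum_square:
  assumes "0 \<le> r" "0 \<le> s"
  shows "(cmod (of_real r * x + of_real s * y))\<^sup>2 \<le> (r + s) * (r * (cmod x)\<^sup>2 + s * (cmod y)\<^sup>2)"
proof -
  have "cmod (of_real r * x + of_real s * y) \<le> r * cmod x + s * cmod y"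
    using norm_triangle_ineq[of "of_real r * x" "of_real s * y"] assms by (simp add: norm_mult)
  then have "(cmod (of_real r * x + of_real s * y))\<^sup>2 \<le> (r * cmod x + s * cmod y)\<^sup>2"
    by (intro power_mono) auto
  also have "\<dots> = (r + s) * (r * (cmod x)\<^sup>2 + s * (cmod y)\<^sup>2) - r * s * (cmod x - cmod y)\<^sup>2"
    by (simp add: power2_eq_square algebra_simps)
  also have "\<dots> \<le> (r + s) * (r * (cmod x)\<^sup>2 + s * (cmod y)\<^sup>2)"
    using assms by simp
  finally show ?thesis .
qed

text \<open>The operator norms of the difference operator and of its inverse are obtained by integrating weighted
Cauchy--Schwarz inequalities, the second one for \<open>h = f + q h(\<cdot> + \<eta>)\<close>.\<close>

lemma norm_bounds_forward_difference:
  assumes "h \<in> L2" "f \<in> L2" "0 < q" "q < 1"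
    and f: "AE t in lborel. f t = h t - of_real q * h (t + \<eta>)"
  shows "(LINT t|lborel. (cmod (f t))\<^sup>2) \<le> (1 + q)\<^sup>2 * (LINT t|lborel. (cmod (h t))\<^sup>2)"
    and "(1 - q)\<^sup>2 * (LINT t|lborel. (cmod (h t))\<^sup>2) \<le> (LINT t|lborel. (cmod (f t))\<^sup>2)"
proof -
  note int = L2_D(2)[OF assms(1)] L2_D(2)[OF assms(2)] L2_D(2)[OF L2_shift(1)[OF assms(1)], of \<eta>]
  note shift = L2_shift(2)[OF assms(1), of \<eta>]
  have "(cmod (x - of_real q * y))\<^sup>2 \<le> (1 + q) * ((cmod x)\<^sup>2 + q * (cmod y)\<^sup>2)" for x y
    using cmod_weighted_sum_square[of 1 q x "- y"] assms(3) by simp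
  then have "(LINT t|lborel. (cmod (f t))\<^sup>2) \<le> (LINT t|lborel. (1 + q) * ((cmod (h t))\<^sup>2 + q * (cmod (h (t + \<eta>)))\<^sup>2))"
    using int f by (intro integral_mono_AE) (auto elim!: eventually_mono)
  also have "\<dots> = (1 + q)\<^sup>2 * (LINT t|lborel. (cmod (h t))\<^sup>2)"
    using int by (simp add: shift) (simp add: power2_eq_square algebra_simps)
  finally show "(LINT t|lborel. (cmod (f t))\<^sup>2) \<le> (1 + q)\<^sup>2 * (LINT t|lborel. (cmod (h t))\<^sup>2)" .
  have "(cmod (z + of_real q * y))\<^sup>2 \<le> (cmod z)\<^sup>2 / (1 - q) + q * (cmod y)\<^sup>2" for z y
  proof -
    have "z + of_real q * y = of_real (1 - q) * (z / of_real (1 - q)) + of_real q * y"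
      using assms(4) by simp
    then have "(cmod (z + of_real q * y))\<^sup>2 \<le> (1 - q) * (cmod (z / of_real (1 - q)))\<^sup>2 + q * (cmod y)\<^sup>2"
      using cmod_weighted_sum_square[of "1 - q" q "z / of_real (1 - q)" y] assms(3,4) by simp
    also have "(1 - q) * (cmod (z / of_real (1 - q)))\<^sup>2 = (cmod z)\<^sup>2 / (1 - q)"
      using assms(4) by (simp only: norm_divide norm_of_real power_divide power2_abs) (simp add: power2_eq_square)
    finally show ?thesis .
  qed
  then have "(cmod x)\<^sup>2 \<le> (cmod (x - of_real q * y))\<^sup>2 / (1 - q) + q * (cmod y)\<^sup>2" for x y
    by (metis diff_add_cancel)
  then have "(LINT t|lborel. (cmod (h t))\<^sup>2) \<le> (LINT t|lborel. (cmod (f t))\<^sup>2 / (1 - q) + q * (cmod (h (t + \<eta>)))\<^sup>2)"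
    using int f by (intro integral_mono_AE) (auto elim!: eventually_mono)
  also have "\<dots> = (LINT t|lborel. (cmod (f t))\<^sup>2) / (1 - q) + q * (LINT t|lborel. (cmod (h t))\<^sup>2)"
    using int by (simp add: shift)
  finally show "(1 - q)\<^sup>2 * (LINT t|lborel. (cmod (h t))\<^sup>2) \<le> (LINT t|lborel. (cmod (f t))\<^sup>2)"
    using assms(4) by (simp add: power2_eq_square field_simps)
qed

lemma nn_integral_shift:
  fixes F :: "real \<Rightarrow> ennreal"
  assumes "F \<in> borel_measurable borel"
  shows "(\<integral>\<^sup>+t. F (t + c) \<partial>lborel) = (\<integral>\<^sup>+t. F t \<partial>lborel)"
  using nn_integral_real_affine[OF assms, of 1 c] by (simp add: add.commute)

text \<open>The preimage is the Neumann series \<open>h(t) = \<Sum>p. q\<^sup>p f(t + p \<eta>)\<close>. Cauchy--Schwarz with weights \<open>q\<^sup>p\<close> bounds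
\<open>|h|\<^sup>2\<close> by a multiple of \<open>\<Sum>p. q\<^sup>p |f(t + p \<eta>)|\<^sup>2\<close>. The latter is integrable and so finite almost everywhere, which is where the
series converges.\<close>

lemma L2_forward_difference_surj:
  assumes "f \<in> L2" "0 < q" "q < 1"
  obtains h where "h \<in> L2" "AE t in lborel. f t = h t - of_real q * h (t + \<eta>)"
proof -
  note [measurable] = L2_D(1)[OF assms(1)]
  \<comment> \<open>\<open>u\<close> are the terms of the series for \<open>h\<close>, \<open>w\<close> those of its quadratic majorant.\<close>
  define u where "u p t = of_real (q ^ p) * f (t + real p * \<eta>)" for p t
  define h where "h t = (\<Sum>p. u p t)" for t
  define w where "w p t = q ^ p * (cmod (f (t + real p * \<eta>)))\<^sup>2" for p t
  have [measurable]: "u p \<in> borel_measurable borel" "w p \<in> borel_measurable borel" for p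
    unfolding u_def w_def by measurable
  have h_meas [measurable]: "h \<in> borel_measurable borel"
    unfolding h_def by measurable
  have geo: "summable (\<lambda>p. q ^ p)" "(\<Sum>p. q ^ p) = 1 / (1 - q)"
    using assms(2,3) by (auto simp: summable_geometric suminf_geometric)
  have w_nonneg: "w p t \<ge> 0" for p t
    using assms(2) by (simp add: w_def)
  have nn_f: "(\<integral>\<^sup>+t. ennreal ((cmod (f t))\<^sup>2) \<partial>lborel) = ennreal (LINT t|lborel. (cmod (f t))\<^sup>2)"
    using L2_D(2)[OF assms(1)] by (intro nn_integral_eq_integral) auto
  have "(\<integral>\<^sup>+t. ennreal (w p t) \<partial>lborel) = ennreal (q ^ p * (LINT t|lborel. (cmod (f t))\<^sup>2))" for p
  proof -
    have "(\<integral>\<^sup>+t. ennreal (w p t) \<partial>lborel) = ennreal (q ^ p) * (\<integral>\<^sup>+t. ennreal ((cmod (f (t + real p * \<eta>)))\<^sup>2) \<partial>lborel)"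
      using assms(2) by (simp add: w_def ennreal_mult nn_integral_cmult)
    also have "(\<integral>\<^sup>+t. ennreal ((cmod (f (t + real p * \<eta>)))\<^sup>2) \<partial>lborel) = ennreal (LINT t|lborel. (cmod (f t))\<^sup>2)"
      using nn_integral_shift[of "\<lambda>t. ennreal ((cmod (f t))\<^sup>2)" "real p * \<eta>"] nn_f by simp
    finally show ?thesis using assms(2) by (simp add: ennreal_mult)
  qed
  then have "(\<integral>\<^sup>+t. (\<Sum>p. ennreal (w p t)) \<partial>lborel) = (\<Sum>p. ennreal (q ^ p * (LINT t|lborel. (cmod (f t))\<^sup>2)))"
    by (subst nn_integral_suminf) simp_all
  also have "\<dots> = ennreal (\<Sum>p. q ^ p * (LINT t|lborel. (cmod (f t))\<^sup>2))"
    using geo(1) assms(2) by (intro suminf_ennreal2 summable_mult2) auto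
  finally have fin: "(\<integral>\<^sup>+t. (\<Sum>p. ennreal (w p t)) \<partial>lborel) < \<infinity>"
    by simp
  then have AE_fin: "AE t in lborel. (\<Sum>p. ennreal (w p t)) \<noteq> \<infinity>"
    by (intro nn_integral_noteq_infinite) auto
  have summable_w: "summable (\<lambda>p. w p t)" if "(\<Sum>p. ennreal (w p t)) \<noteq> \<infinity>" for t
    using that w_nonneg by (intro summable_suminf_not_top) (auto simp: top_ennreal_def)
  have norm_u: "cmod (u p t) = q ^ p * cmod (f (t + real p * \<eta>))" for p t
    using assms(2) by (simp add: u_def norm_mult norm_power)
  have summable_u: "summable (\<lambda>p. cmod (u p t))" if "(\<Sum>p. ennreal (w p t)) \<noteq> \<infinity>" for t
  proof (rule summable_comparison_test')
    show "summable (\<lambda>p. q ^ p + w p t)"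
      by (intro summable_add geo summable_w that)
    have "x \<le> 1 + x\<^sup>2" for x :: real
      using zero_le_power2[of "x - 1 / 2"] by (simp add: power2_eq_square algebra_simps)
    then have "q ^ p * cmod (f (t + real p * \<eta>)) \<le> q ^ p * (1 + (cmod (f (t + real p * \<eta>)))\<^sup>2)" for p
      using assms(2) by (intro mult_left_mono) auto
    then show "norm (cmod (u p t)) \<le> q ^ p + w p t" if "p \<ge> 0" for p
      using assms(2) by (simp add: norm_u w_def distrib_left abs_mult)
  qed
  have bound: "ennreal ((cmod (h t))\<^sup>2) \<le> ennreal (1 / (1 - q)) * (\<Sum>p. ennreal (w p t))" for t
  proof (cases "(\<Sum>p. ennreal (w p t)) = \<infinity>")
    case True
    then show ?thesis using assms(3) by (simp add: ennreal_mult_top)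
  next
    case False
    have sum: "(\<Sum>p<N. cmod (u p t))\<^sup>2 \<le> 1 / (1 - q) * (\<Sum>p. w p t)" for N
    proof -
      have split: "cmod (u p t) = sqrt (q ^ p) * (sqrt (q ^ p) * cmod (f (t + real p * \<eta>)))" for p
        using assms(2) by (simp add: norm_u flip: mult.assoc)
      have "(\<Sum>p<N. cmod (u p t))\<^sup>2 \<le> (\<Sum>p<N. (sqrt (q ^ p))\<^sup>2) * (\<Sum>p<N. (sqrt (q ^ p) * cmod (f (t + real p * \<eta>)))\<^sup>2)"
        unfolding split by (rule Cauchy_Schwarz_ineq_sum)
      also have "\<dots> = (\<Sum>p<N. q ^ p) * (\<Sum>p<N. w p t)"
        using assms(2) by (simp add: w_def power_mult_distrib)
      also have "\<dots> \<le> (\<Sum>p. q ^ p) * (\<Sum>p. w p t)"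
        using assms(2) w_nonneg False
        by (intro mult_mono sum_le_suminf geo summable_w suminf_nonneg sum_nonneg) auto
      finally show ?thesis by (simp only: geo)
    qed
    have "cmod (h t) \<le> (\<Sum>p. cmod (u p t))"
      unfolding h_def by (rule summable_norm[OF summable_u[OF False]])
    then have "(cmod (h t))\<^sup>2 \<le> (\<Sum>p. cmod (u p t))\<^sup>2"
      by (intro power_mono) auto
    also have "\<dots> \<le> 1 / (1 - q) * (\<Sum>p. w p t)"
    proof (rule LIMSEQ_le_const2)
      show "(\<lambda>N. (\<Sum>p<N. cmod (u p t))\<^sup>2) \<longlonglongrightarrow> (\<Sum>p. cmod (u p t))\<^sup>2"
        by (intro tendsto_power summable_LIMSEQ summable_u False)
    qed (use sum in auto)
    finally have "ennreal ((cmod (h t))\<^sup>2) \<le> ennreal (1 / (1 - q) * (\<Sum>p. w p t))"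
      by (rule ennreal_leI)
    also have "\<dots> = ennreal (1 / (1 - q)) * ennreal (\<Sum>p. w p t)"
      using assms(3) by (intro ennreal_mult suminf_nonneg summable_w False w_nonneg) auto
    also have "ennreal (\<Sum>p. w p t) = (\<Sum>p. ennreal (w p t))"
      by (rule suminf_ennreal2[symmetric]) (use w_nonneg summable_w False in auto)
    finally show ?thesis .
  qed
  have "(\<integral>\<^sup>+t. ennreal ((cmod (h t))\<^sup>2) \<partial>lborel) \<le> (\<integral>\<^sup>+t. ennreal (1 / (1 - q)) * (\<Sum>p. ennreal (w p t)) \<partial>lborel)"
    by (rule nn_integral_mono) (rule bound)
  also have "\<dots> = ennreal (1 / (1 - q)) * (\<integral>\<^sup>+t. (\<Sum>p. ennreal (w p t)) \<partial>lborel)"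
    by (rule nn_integral_cmult) simp
  also have "\<dots> < \<infinity>"
    using fin by (simp add: ennreal_mult_less_top)
  finally have "integrable lborel (\<lambda>t. (cmod (h t))\<^sup>2)"
    by (intro integrableI_nonneg) auto
  then have "h \<in> L2" by (simp add: L2_def)
  moreover have "AE t in lborel. f t = h t - of_real q * h (t + \<eta>)"
    using AE_fin
  proof eventually_elim
    case (elim t)
    have sum: "summable (\<lambda>p. u p t)"
      by (rule summable_norm_cancel[OF summable_u[OF elim]])
    have Suc: "u (Suc p) t = of_real q * u p (t + \<eta>)" for p
      by (simp add: u_def algebra_simps)
    have "h t = u 0 t + (\<Sum>p. u (Suc p) t)"
      unfolding h_def using suminf_split_head[OF sum] by simp
    also have "(\<Sum>p. u (Suc p) t) = of_real q * h (t + \<eta>)"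
    proof -
      have "summable (\<lambda>p. of_real q * u p (t + \<eta>))"
        using sum summable_Suc_iff[of "\<lambda>p. u p t"] by (simp add: Suc)
      then have "summable (\<lambda>p. u p (t + \<eta>))"
        using assms(2) by (simp add: summable_cmult_iff)
      then show ?thesis unfolding Suc h_def by (rule suminf_mult)
    qed
    finally show ?case by (simp add: u_def)
  qed
  ultimately show ?thesis by (rule that)
qed

section \<open>Sharp frame bounds\<close>

definition pulse_train :: "(nat \<Rightarrow> real) \<Rightarrow> nat \<Rightarrow> real set \<Rightarrow> real \<Rightarrow> real \<Rightarrow> complex" where
  "pulse_train c N J \<eta> t = of_real (\<Sum>j\<le>N. c j * indicator J (t - real j * \<eta>))"

lemma pulse_train_square:
  assumes "J \<subseteq> {0<..\<eta>}"
  shows "(cmod (pulse_train c N J \<eta> t))\<^sup>2 = (\<Sum>j\<le>N. (c j)\<^sup>2 * indicator J (t - real j * \<eta>))"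
proof -
  let ?i = "\<lambda>j :: nat. indicator J (t - real j * \<eta>) :: real"
  have disj: "i = j" if "t - real i * \<eta> \<in> J" "t - real j * \<eta> \<in> J" for i j :: nat
  proof -
    have bd: "0 < t - real i * \<eta>" "t - real i * \<eta> \<le> \<eta>" "0 < t - real j * \<eta>" "t - real j * \<eta> \<le> \<eta>"
      using that assms by auto
    then have "real i * \<eta> < (real j + 1) * \<eta>" "real j * \<eta> < (real i + 1) * \<eta>" "\<eta> > 0"
      by (auto simp: algebra_simps)
    then have "real i < real j + 1" "real j < real i + 1" by (simp_all only: mult_less_cancel_right_pos)
    then show "i = j" by linarith
  qed
  have "(cmod (pulse_train c N J \<eta> t))\<^sup>2 = (\<Sum>i\<le>N. \<Sum>j\<le>N. (c i * ?i i) * (c j * ?i j))"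
    by (simp only: pulse_train_def norm_of_real power2_abs) (simp only: power2_eq_square sum_product)
  also have "\<dots> = (\<Sum>i\<le>N. \<Sum>j\<le>N. if j = i then (c i)\<^sup>2 * ?i i else 0)"
    using disj by (intro sum.cong refl) (auto simp: power2_eq_square split: split_indicator)
  also have "\<dots> = (\<Sum>i\<le>N. (c i)\<^sup>2 * ?i i)"
    by (intro sum.cong refl) simp
  finally show ?thesis .
qed

lemma pulse_train_L2:
  fixes x\<^sub>0 \<epsilon> \<eta> :: real
  assumes "0 \<le> x\<^sub>0" "0 < \<epsilon>" "x\<^sub>0 + \<epsilon> \<le> \<eta>"
  defines "J \<equiv> {x\<^sub>0<..x\<^sub>0 + \<epsilon>}"
  shows "pulse_train c N J \<eta> \<in> L2"
    and "(LINT t|lborel. (cmod (pulse_train c N J \<eta> t))\<^sup>2) = \<epsilon> * (\<Sum>j\<le>N. (c j)\<^sup>2)"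
proof -
  have J: "J \<subseteq> {0<..\<eta>}" using assms by auto
  have ind: "indicator J (t - real j * \<eta>) = (indicator {x\<^sub>0 + real j * \<eta><..x\<^sub>0 + \<epsilon> + real j * \<eta>} t :: real)" for t j
    by (auto simp: J_def split: split_indicator)
  have int: "integrable lborel (\<lambda>t. indicator J (t - real j * \<eta>) :: real)"
    and integral: "(LINT t|lborel. (indicator J (t - real j * \<eta>) :: real)) = \<epsilon>" for j
    unfolding ind using assms(2) by (auto simp: integrable_indicator_iff)
  have "pulse_train c N J \<eta> \<in> borel_measurable borel"
    unfolding pulse_train_def ind by measurable
  moreover have "integrable lborel (\<lambda>t. \<Sum>j\<le>N. (c j)\<^sup>2 * indicator J (t - real j * \<eta>))"
    by (intro Bochner_Integration.integrable_sum integrable_mult_right int)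
  ultimately show "pulse_train c N J \<eta> \<in> L2"
    unfolding L2_def mem_Collect_eq pulse_train_square[OF J] by simp
  show "(LINT t|lborel. (cmod (pulse_train c N J \<eta> t))\<^sup>2) = \<epsilon> * (\<Sum>j\<le>N. (c j)\<^sup>2)"
  proof -
    have "(LINT t|lborel. (\<Sum>j\<le>N. (c j)\<^sup>2 * indicator J (t - real j * \<eta>)))
        = (\<Sum>j\<le>N. (LINT t|lborel. (c j)\<^sup>2 * indicator J (t - real j * \<eta>)))"
      by (intro Bochner_Integration.integral_sum integrable_mult_right int)
    also have "\<dots> = (\<Sum>j\<le>N. (c j)\<^sup>2 * \<epsilon>)"
      by (simp only: integral_mult_right_zero integral)
    finally show ?thesis
      by (simp only: pulse_train_square[OF J] sum_distrib_left mult.commute)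
  qed
qed

lemma pulse_train_forward_difference:
  assumes "c 0 = 0"
  shows "pulse_train c (Suc M) J \<eta> t - of_real q * pulse_train c (Suc M) J \<eta> (t + \<eta>)
    = pulse_train (\<lambda>j. c j - q * (if j \<le> M then c (Suc j) else 0)) (Suc M) J \<eta> t"
proof -
  have "(\<Sum>j\<le>Suc M. c j * indicator J (t + \<eta> - real j * \<eta>)) = (\<Sum>j\<le>M. c (Suc j) * indicator J (t - real j * \<eta>))"
    using assms by (subst sum.atMost_Suc_shift) (simp add: algebra_simps)
  also have "\<dots> = (\<Sum>j\<le>Suc M. (if j \<le> M then c (Suc j) else 0) * indicator J (t - real j * \<eta>))"
    by simp
  finally have "(\<Sum>j\<le>Suc M. c j * indicator J (t - real j * \<eta>)) - q * (\<Sum>j\<le>Suc M. c j * indicator J (t + \<eta> - real j * \<eta>))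
      = (\<Sum>j\<le>Suc M. (c j - q * (if j \<le> M then c (Suc j) else 0)) * indicator J (t - real j * \<eta>))"
    by (simp only: sum_distrib_left left_diff_distrib sum_subtractf mult.assoc)
  from arg_cong[OF this, of complex_of_real] show ?thesis
    unfolding pulse_train_def by (simp only: of_real_diff of_real_mult)
qed

text \<open>For \<open>h\<close> with amplitudes \<open>\<sigma>, \<sigma>\<^sup>2, \<dots>\<close> all interior amplitudes of \<open>f\<close> have modulus \<open>\<bar>1 - \<sigma> q\<bar>\<close>. If \<open>0 < q < 1\<close>, then as the train
grows the two boundary pulses become negligible and \<open>\<parallel>f\<parallel> / \<parallel>h\<parallel>\<close> tends to \<open>1 - q\<close> for constant signs and to \<open>1 + q\<close> for
alternating ones.\<close>

lemma extremal_pulse_trains: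
  fixes x\<^sub>0 \<epsilon> \<eta> q \<sigma> :: real
  assumes "0 \<le> x\<^sub>0" "0 < \<epsilon>" "x\<^sub>0 + \<epsilon> \<le> \<eta>" "\<sigma> = 1 \<or> \<sigma> = - 1"
  obtains h f where "h \<in> L2" "f \<in> L2" "\<And>t. f t = h t - of_real q * h (t + \<eta>)"
    "(LINT t|lborel. (cmod (h t))\<^sup>2) = \<epsilon> * (1 + real M)"
    "(LINT t|lborel. (cmod (f t))\<^sup>2) = \<epsilon> * (1 + q\<^sup>2 + real M * (1 - \<sigma> * q)\<^sup>2)"
    "\<And>t. h t \<noteq> 0 \<Longrightarrow> \<exists>j :: nat. x\<^sub>0 < t - real j * \<eta> \<and> t - real j * \<eta> \<le> x\<^sub>0 + \<epsilon>"
proof -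
  let ?J = "{x\<^sub>0<..x\<^sub>0 + \<epsilon>}"
  \<comment> \<open>The amplitude \<open>0\<close> at index \<open>0\<close> leaves room for the pulse that the translated copy of \<open>h\<close> adds in front.\<close>
  define c where "c j = (if j = 0 then 0 else \<sigma> ^ j)" for j :: nat
  define d where "d j = c j - q * (if j \<le> M then c (Suc j) else 0)" for j
  have \<sigma>: "(\<sigma> ^ j)\<^sup>2 = 1" for j
    using assms(4) by (auto simp flip: power_mult)
  have sum_c: "(\<Sum>j\<le>Suc M. (c j)\<^sup>2) = 1 + real M"
    by (subst sum.atMost_Suc_shift) (simp add: c_def \<sigma> del: power_Suc)
  have "d 0 = - (q * \<sigma>)" by (simp add: d_def c_def)
  then have d0: "(d 0)\<^sup>2 = q\<^sup>2" using assms(4) by (auto simp: power_mult_distrib)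
  have "d (Suc M) = \<sigma> ^ Suc M" by (simp add: d_def c_def)
  then have d_last: "(d (Suc M))\<^sup>2 = 1" using \<sigma> by metis
  have d_mid: "(d (Suc j))\<^sup>2 = (1 - \<sigma> * q)\<^sup>2" if "j < M" for j
  proof -
    have "d (Suc j) = \<sigma> ^ Suc j * (1 - \<sigma> * q)"
      using that by (simp add: d_def c_def algebra_simps)
    then show ?thesis by (simp only: power_mult_distrib \<sigma>)
  qed
  have "(\<Sum>j\<le>Suc M. (d j)\<^sup>2) = (\<Sum>j\<le>M. (d j)\<^sup>2) + (d (Suc M))\<^sup>2"
    by simp
  also have "(\<Sum>j\<le>M. (d j)\<^sup>2) = (d 0)\<^sup>2 + (\<Sum>j<M. (d (Suc j))\<^sup>2)"
    by (rule sum.atMost_shift)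
  also have "(\<Sum>j<M. (d (Suc j))\<^sup>2) = (\<Sum>j<M. (1 - \<sigma> * q)\<^sup>2)"
    by (intro sum.cong refl d_mid) simp
  finally have sum_d: "(\<Sum>j\<le>Suc M. (d j)\<^sup>2) = 1 + q\<^sup>2 + real M * (1 - \<sigma> * q)\<^sup>2"
    by (simp add: d0 d_last)
  show ?thesis
  proof (rule that[of "pulse_train c (Suc M) ?J \<eta>" "pulse_train d (Suc M) ?J \<eta>"])
    show "pulse_train c (Suc M) ?J \<eta> \<in> L2" "pulse_train d (Suc M) ?J \<eta> \<in> L2"
      by (rule pulse_train_L2(1)[OF assms(1-3)])+
    show "pulse_train d (Suc M) ?J \<eta> t = pulse_train c (Suc M) ?J \<eta> t - of_real q * pulse_train c (Suc M) ?J \<eta> (t + \<eta>)" for t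
      unfolding d_def by (rule pulse_train_forward_difference[symmetric]) (simp add: c_def)
    show "(LINT t|lborel. (cmod (pulse_train c (Suc M) ?J \<eta> t))\<^sup>2) = \<epsilon> * (1 + real M)"
      by (simp only: pulse_train_L2(2)[OF assms(1-3)] sum_c)
    show "(LINT t|lborel. (cmod (pulse_train d (Suc M) ?J \<eta> t))\<^sup>2) = \<epsilon> * (1 + q\<^sup>2 + real M * (1 - \<sigma> * q)\<^sup>2)"
      by (simp only: pulse_train_L2(2)[OF assms(1-3)] sum_d)
    show "\<exists>j :: nat. x\<^sub>0 < t - real j * \<eta> \<and> t - real j * \<eta> \<le> x\<^sub>0 + \<epsilon>" if "pulse_train c (Suc M) ?J \<eta> t \<noteq> 0" for t
    proof (rule ccontr)
      assume "\<not> ?thesis"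
      then have "indicator ?J (t - real j * \<eta>) = (0 :: real)" for j :: nat
        by (auto split: split_indicator)
      then show False using that by (simp add: pulse_train_def)
    qed
  qed
qed

text \<open>Since \<open>\<eta>\<close> is a multiple of the cell length \<open>\<eta> / n\<close>, all pulses occupy the same position in their cells, and
the weight is nearly constant on all of them.\<close>

lemma extremal_pulse_train_gabor_sum:
  fixes \<gamma> \<eta> \<sigma> x\<^sub>0 \<epsilon> :: real and n M :: nat
  assumes "\<gamma> > 0" "\<eta> > 0" "n > 0" "0 \<le> x\<^sub>0" "0 < \<epsilon>" "x\<^sub>0 + \<epsilon> \<le> \<eta> / n" "\<sigma> = 1 \<or> \<sigma> = - 1"
  defines "c \<equiv> 2 * \<gamma> * \<eta> * ((1 - exp (- (2 * \<gamma> * \<eta>))) / (1 - exp (- (2 * \<gamma> * (\<eta> / n)))))"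
  obtains f where "f \<in> L2"
    "(L2_norm f)\<^sup>2 = \<epsilon> * (1 + (exp (- \<gamma> * \<eta>))\<^sup>2 + real M * (1 - \<sigma> * exp (- \<gamma> * \<eta>))\<^sup>2)"
    "ennreal (c * exp (- (2 * \<gamma>) * (x\<^sub>0 + \<epsilon>)) * (\<epsilon> * (1 + real M)))
      \<le> gabor_sum (one_sided_exp \<gamma>) (rect_lattice (\<eta> / n) (1 / \<eta>)) f"
    "gabor_sum (one_sided_exp \<gamma>) (rect_lattice (\<eta> / n) (1 / \<eta>)) f
      \<le> ennreal (c * exp (- (2 * \<gamma>) * x\<^sub>0) * (\<epsilon> * (1 + real M)))"
proof -
  have "\<eta> / n \<le> \<eta>" using assms(2,3) by (simp add: divide_le_eq)
  then have "x\<^sub>0 + \<epsilon> \<le> \<eta>" using assms(6) by linarith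
  then obtain h f where h: "h \<in> L2" "f \<in> L2" "\<And>t. f t = h t - of_real (exp (- \<gamma> * \<eta>)) * h (t + \<eta>)"
    and norms: "(LINT t|lborel. (cmod (h t))\<^sup>2) = \<epsilon> * (1 + real M)"
      "(LINT t|lborel. (cmod (f t))\<^sup>2) = \<epsilon> * (1 + (exp (- \<gamma> * \<eta>))\<^sup>2 + real M * (1 - \<sigma> * exp (- \<gamma> * \<eta>))\<^sup>2)"
    and supp: "\<And>t. h t \<noteq> 0 \<Longrightarrow> \<exists>j :: nat. x\<^sub>0 < t - real j * \<eta> \<and> t - real j * \<eta> \<le> x\<^sub>0 + \<epsilon>"
    using extremal_pulse_trains[OF assms(4,5) _ assms(7), of \<eta> "exp (- \<gamma> * \<eta>)" M] by blast
  have AE: "AE t in lborel. f t = h t - of_real (exp (- \<gamma> * \<eta>)) * h (t + \<eta>)"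
    using h(3) by simp
  have cell: "\<forall>t. h t \<noteq> 0 \<longrightarrow>
    (\<exists>k :: int. \<eta> / n * of_int k < t \<and> t \<le> \<eta> / n * (of_int k + 1) \<and> x\<^sub>0 \<le> t - \<eta> / n * of_int k \<and> t - \<eta> / n * of_int k \<le> x\<^sub>0 + \<epsilon>)"
  proof (intro allI impI)
    fix t assume "h t \<noteq> 0"
    then obtain j :: nat where j: "x\<^sub>0 < t - real j * \<eta>" "t - real j * \<eta> \<le> x\<^sub>0 + \<epsilon>"
      using supp by blast
    \<comment> \<open>The pulse at \<open>j \<eta>\<close> starts in the cell with index \<open>j n\<close>.\<close>
    define k where "k = int (j * n)"
    have k: "\<eta> / n * of_int k = real j * \<eta>" "\<eta> / n * (of_int k + 1) = real j * \<eta> + \<eta> / n"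
      using assms(3) by (auto simp: k_def field_simps)
    show "\<exists>k :: int. \<eta> / n * of_int k < t \<and> t \<le> \<eta> / n * (of_int k + 1) \<and> x\<^sub>0 \<le> t - \<eta> / n * of_int k \<and> t - \<eta> / n * of_int k \<le> x\<^sub>0 + \<epsilon>"
      by (intro exI[of _ k] conjI; simp only: k; use j assms(4,6) in linarith)
  qed
  show ?thesis
    using gabor_sum_bounds[OF assms(1-3) h(1,2) AE cell]
    by (intro that[of f]) (simp_all only: h(2) L2_norm_square norms c_def)
qed

lemma
  fixes \<gamma> \<eta> :: real and n :: nat
  assumes "\<gamma> > 0" "\<eta> > 0" "n > 0"
  defines "q \<equiv> exp (- \<gamma> * \<eta>)"
    and "c \<equiv> 2 * \<gamma> * \<eta> * ((1 - exp (- (2 * \<gamma> * \<eta>))) / (1 - exp (- (2 * \<gamma> * (\<eta> / n)))))"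
    and "S \<equiv> gabor_sum (one_sided_exp \<gamma>) (rect_lattice (\<eta> / n) (1 / \<eta>))"
  assumes "f \<in> L2"
  shows gabor_sum_lower_bound: "ennreal (c * exp (- (2 * \<gamma>) * (\<eta> / n)) / (1 + q)\<^sup>2 * (L2_norm f)\<^sup>2) \<le> S f"
    and gabor_sum_upper_bound: "S f \<le> ennreal (c / (1 - q)\<^sup>2 * (L2_norm f)\<^sup>2)"
proof -
  have q: "0 < q" "q < 1" using assms(1,2) by (auto simp: q_def)
  have c: "c > 0"
    unfolding c_def using assms(1-3) by (intro mult_pos_pos divide_pos_pos) auto
  obtain h where h: "h \<in> L2" and f: "AE t in lborel. f t = h t - of_real q * h (t + \<eta>)"
    using L2_forward_difference_surj[OF \<open>f \<in> L2\<close> q] .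
  note norms = norm_bounds_forward_difference[OF h \<open>f \<in> L2\<close> q f, folded L2_norm_square]
  have a: "\<eta> / n > 0" using assms(2,3) by simp
  have cell: "\<forall>t. h t \<noteq> 0 \<longrightarrow>
    (\<exists>k :: int. \<eta> / n * of_int k < t \<and> t \<le> \<eta> / n * (of_int k + 1) \<and> 0 \<le> t - \<eta> / n * of_int k \<and> t - \<eta> / n * of_int k \<le> \<eta> / n)"
  proof (intro allI impI)
    fix t
    obtain k :: int where k: "\<eta> / n * of_int k < t" "t \<le> \<eta> / n * (of_int k + 1)"
      using lattice_cell[OF a] .
    then show "\<exists>k :: int. \<eta> / n * of_int k < t \<and> t \<le> \<eta> / n * (of_int k + 1) \<and> 0 \<le> t - \<eta> / n * of_int k \<and> t - \<eta> / n * of_int k \<le> \<eta> / n"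
      by (intro exI[of _ k]) (simp add: distrib_left)
  qed
  have bounds: "ennreal (c * exp (- (2 * \<gamma>) * (\<eta> / n)) * (L2_norm h)\<^sup>2) \<le> S f" "S f \<le> ennreal (c * exp (- (2 * \<gamma>) * 0) * (L2_norm h)\<^sup>2)"
    using gabor_sum_bounds[OF assms(1-3) h \<open>f \<in> L2\<close> f[unfolded q_def] cell]
    by (simp_all only: L2_norm_square c_def S_def)
  have "c * exp (- (2 * \<gamma>) * (\<eta> / n)) / (1 + q)\<^sup>2 * (L2_norm f)\<^sup>2
      \<le> c * exp (- (2 * \<gamma>) * (\<eta> / n)) / (1 + q)\<^sup>2 * ((1 + q)\<^sup>2 * (L2_norm h)\<^sup>2)"
    using c by (intro mult_left_mono norms) auto
  also have "\<dots> = c * exp (- (2 * \<gamma>) * (\<eta> / n)) * (L2_norm h)\<^sup>2"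
    using q by simp
  finally show "ennreal (c * exp (- (2 * \<gamma>) * (\<eta> / n)) / (1 + q)\<^sup>2 * (L2_norm f)\<^sup>2) \<le> S f"
    using bounds(1) by (meson ennreal_leI order_trans)
  have "c * exp (- (2 * \<gamma>) * 0) * (L2_norm h)\<^sup>2 = c / (1 - q)\<^sup>2 * ((1 - q)\<^sup>2 * (L2_norm h)\<^sup>2)"
    using q by simp
  also have "\<dots> \<le> c / (1 - q)\<^sup>2 * (L2_norm f)\<^sup>2"
    using c by (intro mult_left_mono norms) auto
  finally show "S f \<le> ennreal (c / (1 - q)\<^sup>2 * (L2_norm f)\<^sup>2)"
    using bounds(2) by (meson ennreal_leI order_trans)
qed

text \<open>The sharp lower bound as a function of \<open>s = \<gamma> \<eta>\<close>: \<open>2 s tanh (s / 2) / (exp (2 s / n) - 1)\<close>.\<close>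

definition lower_bound_fun :: "real \<Rightarrow> real \<Rightarrow> real" where
  "lower_bound_fun n s = 2 * s * (1 - exp (- s)) / ((1 + exp (- s)) * (exp (2 * s / n) - 1))"

text \<open>The sharp upper bound as a function of \<open>s = \<gamma> \<eta>\<close>: \<open>2 s coth (s / 2) / (1 - exp (- 2 s / n))\<close>.\<close>

definition upper_bound_fun :: "real \<Rightarrow> real \<Rightarrow> real" where
  "upper_bound_fun n s = 2 * s * (1 + exp (- s)) / ((1 - exp (- s)) * (1 - exp (- (2 * s / n))))"

text \<open>Sharpness is tested on alternating trains of \<open>M + 1\<close> pulses at the right ends of the cells, where the weight is
smallest. Letting the pulse width \<open>a / (M + 1)\<close> shrink while the train grows needs only a single limit.\<close>

lemma sharp_lower_frame_bound_one_sided_exp: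
  fixes \<gamma> \<eta> :: real and n :: nat
  assumes "\<gamma> > 0" "\<eta> > 0" "n > 0"
  shows "sharp_lower_frame_bound (one_sided_exp \<gamma>) (rect_lattice (\<eta> / n) (1 / \<eta>))
    = ennreal (lower_bound_fun n (\<gamma> * \<eta>))"
proof -
  define q where "q = exp (- \<gamma> * \<eta>)"
  define a where "a = \<eta> / n"
  define c where "c = 2 * \<gamma> * \<eta> * ((1 - exp (- (2 * \<gamma> * \<eta>))) / (1 - exp (- (2 * \<gamma> * a))))"
  let ?g = "one_sided_exp \<gamma>" and ?\<Lambda> = "rect_lattice a (1 / \<eta>)"
  have q: "0 < q" "q < 1" using assms(1,2) by (auto simp: q_def)
  have a: "a > 0" using assms by (simp add: a_def)
  have c: "c > 0"
    unfolding c_def a_def using assms by (intro mult_pos_pos divide_pos_pos) auto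
  let ?L = "c * exp (- (2 * \<gamma>) * a) / (1 + q)\<^sup>2"
  have "lower_frame_bound ?g ?\<Lambda> (ennreal ?L)"
    unfolding lower_frame_bound_def
  proof
    fix f assume "f \<in> L2"
    then have "ennreal (?L * (L2_norm f)\<^sup>2) \<le> gabor_sum ?g ?\<Lambda> f"
      using gabor_sum_lower_bound[OF assms] by (simp only: q_def c_def a_def)
    moreover have "ennreal ?L * ennreal ((L2_norm f)\<^sup>2) = ennreal (?L * (L2_norm f)\<^sup>2)"
      using c by (intro ennreal_mult[symmetric]) auto
    ultimately show "ennreal ?L * ennreal ((L2_norm f)\<^sup>2) \<le> gabor_sum ?g ?\<Lambda> f"
      by (simp only:)
  qed
  moreover have "A \<le> ennreal ?L" if A: "lower_frame_bound ?g ?\<Lambda> A" for A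
  proof -
    let ?v = "\<lambda>M. inverse (real (Suc M))"
    define N where "N M = 1 + q\<^sup>2 + real M * (1 + q)\<^sup>2" for M
    have N: "N M > 0" for M
      using q by (auto simp: N_def intro!: add_pos_nonneg)
    have step: "A * ennreal (N M) \<le> ennreal (c * exp (- (2 * \<gamma>) * (a - a * ?v M)) * (1 + real M))" for M
    proof -
      have "a * ?v M \<le> a"
        using a by (intro mult_left_le) (auto simp: inverse_le_1_iff)
      then have \<epsilon>: "0 < a * ?v M" "0 \<le> a - a * ?v M" "a - a * ?v M + a * ?v M \<le> \<eta> / n"
        using mult_pos_pos[OF a, of "?v M"] by (simp_all add: a_def)
      obtain f where f: "f \<in> L2" "(L2_norm f)\<^sup>2 = a * ?v M * (1 + (exp (- \<gamma> * \<eta>))\<^sup>2 + real M * (1 - (- 1) * exp (- \<gamma> * \<eta>))\<^sup>2)"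
        "gabor_sum ?g ?\<Lambda> f \<le> ennreal (c * exp (- (2 * \<gamma>) * (a - a * ?v M)) * (a * ?v M * (1 + real M)))"
        using extremal_pulse_train_gabor_sum[OF assms \<epsilon>(2,1,3) disjI2[OF refl], of M, folded a_def, folded c_def] by blast
      have "(L2_norm f)\<^sup>2 = N M * (a * ?v M)"
        by (simp add: f(2) N_def q_def mult.commute)
      then have "A * ennreal (N M) * ennreal (a * ?v M) = A * ennreal ((L2_norm f)\<^sup>2)"
        using N[of M] \<epsilon>(1) by (simp only: ennreal_mult less_imp_le mult.assoc)
      also have "\<dots> \<le> gabor_sum ?g ?\<Lambda> f"
        using A f(1) by (auto simp: lower_frame_bound_def)
      also have "\<dots> \<le> ennreal (c * exp (- (2 * \<gamma>) * (a - a * ?v M)) * (a * ?v M * (1 + real M)))"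
        by (rule f(3))
      also have "\<dots> = ennreal (c * exp (- (2 * \<gamma>) * (a - a * ?v M)) * (1 + real M)) * ennreal (a * ?v M)"
      proof -
        have "c * exp (- (2 * \<gamma>) * (a - a * ?v M)) * (a * ?v M * (1 + real M))
            = c * exp (- (2 * \<gamma>) * (a - a * ?v M)) * (1 + real M) * (a * ?v M)"
          by (simp only: mult_ac)
        moreover have "0 \<le> c * exp (- (2 * \<gamma>) * (a - a * ?v M)) * (1 + real M)"
          using c by simp
        ultimately show ?thesis
          using \<epsilon>(1) by (simp only: ennreal_mult less_imp_le)
      qed
      finally show ?thesis
        using \<epsilon>(1) by (subst (asm) (1 2) mult.commute, subst (asm) ennreal_mult_le_mult_iff) auto
    qed
    have "A \<noteq> \<infinity>"
      using step[of 0] N[of 0] by (auto simp: ennreal_top_mult top_unique)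
    then obtain r where r: "A = ennreal r" "r \<ge> 0"
      by (cases A) auto
    have "r * ((1 + q)\<^sup>2 + (1 + q\<^sup>2 - (1 + q)\<^sup>2) * ?v M) \<le> c * exp (- (2 * \<gamma>) * (a - a * ?v M))" for M
    proof -
      have "r * N M \<le> c * exp (- (2 * \<gamma>) * (a - a * ?v M)) * (1 + real M)"
        using step[of M] N[of M] r c by (simp add: ennreal_mult[symmetric])
      then have "r * N M * ?v M \<le> c * exp (- (2 * \<gamma>) * (a - a * ?v M)) * (1 + real M) * ?v M"
        by (intro mult_right_mono) auto
      moreover have "(1 + real M) * ?v M = 1" by (simp add: field_simps)
      moreover have "N M * ?v M = (1 + q)\<^sup>2 + (1 + q\<^sup>2 - (1 + q)\<^sup>2) * ?v M"
        by (simp add: N_def field_simps)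
      ultimately show ?thesis by (simp only: mult.assoc mult_1_right)
    qed
    moreover have "(\<lambda>M. r * ((1 + q)\<^sup>2 + (1 + q\<^sup>2 - (1 + q)\<^sup>2) * ?v M)) \<longlonglongrightarrow> r * ((1 + q)\<^sup>2 + (1 + q\<^sup>2 - (1 + q)\<^sup>2) * 0)"
      by (intro tendsto_intros LIMSEQ_inverse_real_of_nat)
    moreover have "(\<lambda>M. c * exp (- (2 * \<gamma>) * (a - a * ?v M))) \<longlonglongrightarrow> c * exp (- (2 * \<gamma>) * (a - a * 0))"
      by (intro tendsto_intros LIMSEQ_inverse_real_of_nat)
    ultimately have "r * ((1 + q)\<^sup>2 + (1 + q\<^sup>2 - (1 + q)\<^sup>2) * 0) \<le> c * exp (- (2 * \<gamma>) * (a - a * 0))"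
      by (intro LIMSEQ_le) auto
    then have "r \<le> ?L" using q by (simp add: pos_le_divide_eq)
    then show ?thesis unfolding r(1) by (rule ennreal_leI)
  qed
  ultimately have "sharp_lower_frame_bound ?g ?\<Lambda> = ennreal ?L"
    unfolding sharp_lower_frame_bound_def by (intro antisym Sup_least Sup_upper) auto
  also have "?L = lower_bound_fun n (\<gamma> * \<eta>)"
  proof -
    define y where "y = 2 * (\<gamma> * \<eta>) / n"
    have y: "y > 0" using assms by (simp add: y_def)
    have "c = 2 * (\<gamma> * \<eta>) * ((1 - q) * (1 + q) / (1 - exp (- y)))"
      by (simp add: c_def q_def y_def a_def algebra_simps flip: exp_add)
    moreover have "exp (- (2 * \<gamma>) * a) = exp (- y)" by (simp add: a_def y_def)
    moreover have "exp (- y) / (1 - exp (- y)) = 1 / (exp y - 1)"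
      using y by (simp add: frac_eq_eq algebra_simps flip: exp_add)
    moreover have "2 * (\<gamma> * \<eta>) * ((1 - q) * (1 + q) / (1 - exp (- y))) * exp (- y) / (1 + q)\<^sup>2
        = 2 * (\<gamma> * \<eta>) * ((1 - q) / (1 + q)) * (exp (- y) / (1 - exp (- y)))"
    proof -
      have "X * (p * r / D) * e / r\<^sup>2 = X * (p / r) * (e / D)" if "r \<noteq> 0" for X p r D e :: real
        using that by (cases "D = 0") (auto simp: field_simps power2_eq_square)
      then show ?thesis using q by simp
    qed
    ultimately have "?L = 2 * (\<gamma> * \<eta>) * ((1 - q) / (1 + q)) * (1 / (exp y - 1))"
      by (simp only:)
    then show ?thesis by (simp add: lower_bound_fun_def q_def y_def)
  qed
  finally show ?thesis by (simp only: a_def)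
qed

text \<open>The extremal trains now have constant sign and sit at the left ends of the cells, where the weight is largest.\<close>

lemma sharp_upper_frame_bound_one_sided_exp:
  fixes \<gamma> \<eta> :: real and n :: nat
  assumes "\<gamma> > 0" "\<eta> > 0" "n > 0"
  shows "sharp_upper_frame_bound (one_sided_exp \<gamma>) (rect_lattice (\<eta> / n) (1 / \<eta>))
    = ennreal (upper_bound_fun n (\<gamma> * \<eta>))"
proof -
  define q where "q = exp (- \<gamma> * \<eta>)"
  define a where "a = \<eta> / n"
  define c where "c = 2 * \<gamma> * \<eta> * ((1 - exp (- (2 * \<gamma> * \<eta>))) / (1 - exp (- (2 * \<gamma> * a))))"
  let ?g = "one_sided_exp \<gamma>" and ?\<Lambda> = "rect_lattice a (1 / \<eta>)"
  have q: "0 < q" "q < 1" using assms(1,2) by (auto simp: q_def)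
  have a: "a > 0" using assms by (simp add: a_def)
  have c: "c > 0"
    unfolding c_def a_def using assms by (intro mult_pos_pos divide_pos_pos) auto
  let ?U = "c / (1 - q)\<^sup>2"
  have "upper_frame_bound ?g ?\<Lambda> (ennreal ?U)"
    unfolding upper_frame_bound_def
  proof
    fix f assume "f \<in> L2"
    then have "gabor_sum ?g ?\<Lambda> f \<le> ennreal (?U * (L2_norm f)\<^sup>2)"
      using gabor_sum_upper_bound[OF assms] by (simp only: q_def c_def a_def)
    moreover have "ennreal ?U * ennreal ((L2_norm f)\<^sup>2) = ennreal (?U * (L2_norm f)\<^sup>2)"
      using c by (intro ennreal_mult[symmetric]) auto
    ultimately show "gabor_sum ?g ?\<Lambda> f \<le> ennreal ?U * ennreal ((L2_norm f)\<^sup>2)"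
      by (simp only:)
  qed
  moreover have "ennreal ?U \<le> B" if B: "upper_frame_bound ?g ?\<Lambda> B" for B
  proof (cases "B = \<infinity>")
    case False
    then obtain r where r: "B = ennreal r" "r \<ge> 0"
      by (cases B) auto
    let ?v = "\<lambda>M. inverse (real (Suc M))"
    define N where "N M = 1 + q\<^sup>2 + real M * (1 - q)\<^sup>2" for M
    have N: "N M > 0" for M
      using q by (auto simp: N_def intro!: add_pos_nonneg)
    have "c * exp (- (2 * \<gamma>) * (a * ?v M)) \<le> r * ((1 - q)\<^sup>2 + (1 + q\<^sup>2 - (1 - q)\<^sup>2) * ?v M)" for M
    proof -
      have "a * ?v M \<le> a"
        using a by (intro mult_left_le) (auto simp: inverse_le_1_iff)
      then have \<epsilon>: "0 < a * ?v M" "0 + a * ?v M \<le> \<eta> / n"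
        using mult_pos_pos[OF a, of "?v M"] by (simp_all add: a_def)
      obtain f where f: "f \<in> L2" "(L2_norm f)\<^sup>2 = a * ?v M * (1 + (exp (- \<gamma> * \<eta>))\<^sup>2 + real M * (1 - 1 * exp (- \<gamma> * \<eta>))\<^sup>2)"
        "ennreal (c * exp (- (2 * \<gamma>) * (0 + a * ?v M)) * (a * ?v M * (1 + real M))) \<le> gabor_sum ?g ?\<Lambda> f"
        using extremal_pulse_train_gabor_sum[OF assms order.refl \<epsilon> disjI1[OF refl], of M, folded a_def, folded c_def] by blast
      have norm: "(L2_norm f)\<^sup>2 = N M * (a * ?v M)"
        by (simp add: f(2) N_def q_def mult.commute)
      note f(3)
      also have "gabor_sum ?g ?\<Lambda> f \<le> B * ennreal ((L2_norm f)\<^sup>2)"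
        using B f(1) by (auto simp: upper_frame_bound_def)
      also have "\<dots> = ennreal (r * (N M * (a * ?v M)))"
        using r N[of M] \<epsilon>(1) by (simp add: norm ennreal_mult)
      finally have "c * exp (- (2 * \<gamma>) * (0 + a * ?v M)) * (a * ?v M * (1 + real M)) \<le> r * (N M * (a * ?v M))"
        using r N[of M] \<epsilon>(1) by (subst (asm) ennreal_le_iff) auto
      moreover have "a * ?v M * (1 + real M) = a" by (simp add: field_simps)
      moreover have "N M * (a * ?v M) = ((1 - q)\<^sup>2 + (1 + q\<^sup>2 - (1 - q)\<^sup>2) * ?v M) * a"
        by (simp add: N_def field_simps)
      ultimately have "c * exp (- (2 * \<gamma>) * (a * ?v M)) * a \<le> r * ((1 - q)\<^sup>2 + (1 + q\<^sup>2 - (1 - q)\<^sup>2) * ?v M) * a"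
        by (simp only: mult.assoc add_0)
      then show ?thesis using a by (simp only: mult_le_cancel_right_pos)
    qed
    moreover have "(\<lambda>M. r * ((1 - q)\<^sup>2 + (1 + q\<^sup>2 - (1 - q)\<^sup>2) * ?v M)) \<longlonglongrightarrow> r * ((1 - q)\<^sup>2 + (1 + q\<^sup>2 - (1 - q)\<^sup>2) * 0)"
      by (intro tendsto_intros LIMSEQ_inverse_real_of_nat)
    moreover have "(\<lambda>M. c * exp (- (2 * \<gamma>) * (a * ?v M))) \<longlonglongrightarrow> c * exp (- (2 * \<gamma>) * (a * 0))"
      by (intro tendsto_intros LIMSEQ_inverse_real_of_nat)
    ultimately have "c * exp (- (2 * \<gamma>) * (a * 0)) \<le> r * ((1 - q)\<^sup>2 + (1 + q\<^sup>2 - (1 - q)\<^sup>2) * 0)"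
      by (intro LIMSEQ_le) auto
    then have "?U \<le> r" using q by (simp add: pos_divide_le_eq)
    then show ?thesis unfolding r(1) by (rule ennreal_leI)
  qed simp
  ultimately have "sharp_upper_frame_bound ?g ?\<Lambda> = ennreal ?U"
    unfolding sharp_upper_frame_bound_def by (intro antisym Inf_greatest Inf_lower) auto
  also have "?U = upper_bound_fun n (\<gamma> * \<eta>)"
  proof -
    define y where "y = 2 * (\<gamma> * \<eta>) / n"
    have "c = 2 * (\<gamma> * \<eta>) * ((1 - q) * (1 + q) / (1 - exp (- y)))"
      by (simp add: c_def q_def y_def a_def algebra_simps flip: exp_add)
    then have "?U = 2 * (\<gamma> * \<eta>) * (1 + q) / ((1 - q) * (1 - exp (- y)))"
      using q by (simp add: power2_eq_square mult_ac)
    then show ?thesis by (simp add: upper_bound_fun_def q_def y_def)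
  qed
  finally show ?thesis by (simp only: a_def)
qed

section \<open>Extremizing the frame bounds\<close>

lemma sinh_less_mult_cosh:
  fixes s :: real
  assumes "s > 0"
  shows "sinh s < s * cosh s"
proof -
  have "0 * cosh 0 - sinh 0 < s * cosh s - sinh s"
  proof (rule DERIV_pos_imp_increasing_open[OF assms])
    fix x :: real assume "0 < x"
    moreover have "((\<lambda>x. x * cosh x - sinh x) has_real_derivative x * sinh x) (at x)"
      by (auto intro!: derivative_eq_intros)
    ultimately show "\<exists>y. ((\<lambda>x. x * cosh x - sinh x) has_real_derivative y) (at x) \<and> y > 0"
      by (auto intro!: exI[of _ "x * sinh x"])
  qed (intro continuous_intros)
  then show ?thesis by simp
qed

text \<open>The monotonicity of \<open>s / sinh s\<close>, \<open>y / (exp y - 1)\<close> and \<open>y / (1 - exp (- y))\<close> makes the zeros of the logarithmic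
derivatives unique.\<close>

lemma strict_antimono_div_sinh:
  fixes s t :: real
  assumes "0 < s" "s < t"
  shows "t / sinh t < s / sinh s"
proof (rule DERIV_neg_imp_decreasing[OF assms(2)])
  fix x assume "s \<le> x"
  then have "x > 0" using assms(1) by simp
  then have "((\<lambda>x. x / sinh x) has_real_derivative (sinh x - x * cosh x) / (sinh x)\<^sup>2) (at x)"
    by (auto intro!: derivative_eq_intros simp: power2_eq_square)
  moreover have "(sinh x - x * cosh x) / (sinh x)\<^sup>2 < 0"
    using sinh_less_mult_cosh[OF \<open>x > 0\<close>] \<open>x > 0\<close> by (simp add: divide_neg_pos)
  ultimately show "\<exists>y. ((\<lambda>x. x / sinh x) has_real_derivative y) (at x) \<and> y < 0"
    by blast
qed

lemma mult_exp_gt_exp_minus_one: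
  fixes y :: real
  assumes "y > 0"
  shows "exp y - 1 < y * exp y"
proof -
  have "(1 - y) * exp y < exp (- y) * exp y"
    using assms exp_minus_greater[of y] by (intro mult_strict_right_mono) auto
  then show ?thesis by (simp add: algebra_simps flip: exp_add)
qed

lemma strict_antimono_div_exp_minus_one:
  fixes y z :: real
  assumes "0 < y" "y < z"
  shows "z / (exp z - 1) < y / (exp y - 1)"
proof (rule DERIV_neg_imp_decreasing[OF assms(2)])
  fix x assume "y \<le> x"
  then have "x > 0" using assms(1) by simp
  then have "((\<lambda>x. x / (exp x - 1)) has_real_derivative (exp x - 1 - x * exp x) / (exp x - 1)\<^sup>2) (at x)"
    by (auto intro!: derivative_eq_intros simp: power2_eq_square)
  moreover have "(exp x - 1 - x * exp x) / (exp x - 1)\<^sup>2 < 0"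
    using mult_exp_gt_exp_minus_one[OF \<open>x > 0\<close>] \<open>x > 0\<close> by (simp add: divide_neg_pos)
  ultimately show "\<exists>y. ((\<lambda>x. x / (exp x - 1)) has_real_derivative y) (at x) \<and> y < 0"
    by blast
qed

lemma strict_mono_div_one_minus_exp:
  fixes y z :: real
  assumes "0 < y" "y < z"
  shows "y / (1 - exp (- y)) < z / (1 - exp (- z))"
proof (rule DERIV_pos_imp_increasing[OF assms(2)])
  fix x assume "y \<le> x"
  then have "x > 0" using assms(1) by simp
  then have "((\<lambda>x. x / (1 - exp (- x))) has_real_derivative (1 - exp (- x) - x * exp (- x)) / (1 - exp (- x))\<^sup>2) (at x)"
    by (auto intro!: derivative_eq_intros simp: power2_eq_square)
  moreover have "(1 - exp (- x) - x * exp (- x)) / (1 - exp (- x))\<^sup>2 > 0"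
  proof -
    have "(1 + x) * exp (- x) < exp x * exp (- x)"
      using \<open>x > 0\<close> exp_minus_greater[of "- x"] by (intro mult_strict_right_mono) auto
    then show ?thesis using \<open>x > 0\<close> by (simp add: algebra_simps flip: exp_add)
  qed
  ultimately show "\<exists>y. ((\<lambda>x. x / (1 - exp (- x))) has_real_derivative y) (at x) \<and> 0 < y"
    by blast
qed

lemma div_one_minus_exp:
  fixes y :: real
  assumes "y > 0"
  shows "y / (1 - exp (- y)) = y + y / (exp y - 1)"
proof -
  have "exp y > 1" using assms by simp
  then show ?thesis by (simp add: exp_minus field_simps)
qed

text \<open>This is \<open>(y / 2) coth (y / 2) > 1\<close>. It makes the logarithmic derivatives of both bounds negative at
\<open>s = arsinh n\<close>, and so puts the two extremal points on opposite sides of it.\<close>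

lemma one_plus_half_less_div_one_minus_exp:
  fixes y :: real
  assumes "y > 0"
  shows "1 + y / 2 < y / (1 - exp (- y))"
proof -
  have "(0 - 2) * exp 0 + 0 + 2 < (y - 2) * exp y + y + 2"
  proof (rule DERIV_pos_imp_increasing_open[OF assms])
    fix x :: real assume "0 < x"
    have "((\<lambda>x. (x - 2) * exp x + x + 2) has_real_derivative (1 * exp x + (x - 2) * exp x + 1)) (at x)"
      by (auto intro!: derivative_eq_intros)
    then show "\<exists>y. ((\<lambda>x. (x - 2) * exp x + x + 2) has_real_derivative y) (at x) \<and> y > 0"
      using mult_exp_gt_exp_minus_one[OF \<open>0 < x\<close>] by (auto simp: algebra_simps intro!: exI)
  qed (intro continuous_intros)
  then have "0 < ((y - 2) * exp y + y + 2) * exp (- y)"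
    by simp
  also have "\<dots> = y - 2 + (y + 2) * exp (- y)"
    by (simp add: algebra_simps flip: exp_add)
  finally show ?thesis
    using assms by (simp add: field_simps)
qed

lemma strict_maximum_if_derivative_sign:
  fixes F F' :: "real \<Rightarrow> real"
  assumes D: "\<And>s. s > 0 \<Longrightarrow> (F has_real_derivative F' s) (at s)"
    and pos: "\<And>s. 0 < s \<Longrightarrow> s < m \<Longrightarrow> F' s > 0"
    and neg: "\<And>s. m < s \<Longrightarrow> F' s < 0"
    and "m > 0" "s > 0" "s \<noteq> m"
  shows "F s < F m"
proof -
  have cont: "continuous_on {a..b} F" if "a > 0" for a b
    using DERIV_isCont[OF D] that by (intro continuous_at_imp_continuous_on) auto
  show ?thesis
  proof (cases "s < m")
    case True
    show ?thesis
    proof (rule DERIV_pos_imp_increasing_open[OF True])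
      show "\<exists>y. (F has_real_derivative y) (at x) \<and> y > 0" if "s < x" "x < m" for x
        using D[of x] pos[of x] that \<open>s > 0\<close> by auto
    qed (rule cont[OF \<open>s > 0\<close>])
  next
    case False
    then have "m < s" using \<open>s \<noteq> m\<close> by simp
    then show ?thesis
    proof (rule DERIV_neg_imp_decreasing_open)
      show "\<exists>y. (F has_real_derivative y) (at x) \<and> y < 0" if "m < x" "x < s" for x
        using D[of x] neg[of x] that \<open>m > 0\<close> by auto
    qed (rule cont[OF \<open>m > 0\<close>])
  qed
qed

lemma lower_bound_fun_pos: "n > 0 \<Longrightarrow> s > 0 \<Longrightarrow> lower_bound_fun n s > 0"
  unfolding lower_bound_fun_def by (intro divide_pos_pos mult_pos_pos) (auto intro: add_pos_pos)

lemma upper_bound_fun_pos: "n > 0 \<Longrightarrow> s > 0 \<Longrightarrow> upper_bound_fun n s > 0"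
  unfolding upper_bound_fun_def by (intro divide_pos_pos mult_pos_pos) (auto intro: add_pos_pos)

text \<open>The logarithmic derivative of \<open>tanh (s / 2)\<close>, written in terms of \<open>exp (- s)\<close>.\<close>

lemma inverse_sinh_exp:
  fixes s :: real
  assumes "s > 0"
  shows "exp (- s) / (1 - exp (- s)) + exp (- s) / (1 + exp (- s)) = 1 / sinh s"
proof -
  have nz: "1 - exp (- s) \<noteq> 0" "1 + exp (- s) \<noteq> 0" "sinh s \<noteq> 0"
    using assms by (auto simp: add_nonneg_eq_0_iff)
  have "exp (- s) / (1 - exp (- s)) + exp (- s) / (1 + exp (- s)) = 2 * exp (- s) / ((1 - exp (- s)) * (1 + exp (- s)))"
    using nz by (simp add: add_frac_eq algebra_simps)
  also have "\<dots> = 1 / sinh s"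
    using nz by (simp add: frac_eq_eq sinh_field_def algebra_simps flip: exp_add)
  finally show ?thesis .
qed

lemma ln_lower_bound_fun_derivative:
  assumes "n > 0" "s > 0"
  shows "((\<lambda>s. ln (lower_bound_fun n s)) has_real_derivative
    (1 + s / sinh s - (2 * s / n) / (1 - exp (- (2 * s / n)))) / s) (at s)"
proof -
  let ?G = "\<lambda>s. ln 2 + ln s + ln (1 - exp (- s)) - ln (1 + exp (- s)) - ln (exp (2 * s / n) - 1)"
  have "(?G has_real_derivative
      1 / s + exp (- s) / (1 - exp (- s)) + exp (- s) / (1 + exp (- s)) - (2 / n) * exp (2 * s / n) / (exp (2 * s / n) - 1)) (at s)"
    using assms by (auto intro!: derivative_eq_intros add_pos_pos simp: field_simps)
  also have "1 / s + exp (- s) / (1 - exp (- s)) + exp (- s) / (1 + exp (- s)) - (2 / n) * exp (2 * s / n) / (exp (2 * s / n) - 1)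
      = 1 / s + 1 / sinh s - (2 / n) * (exp (2 * s / n) / (exp (2 * s / n) - 1))"
    using inverse_sinh_exp[OF assms(2)] by simp
  also have "exp (2 * s / n) / (exp (2 * s / n) - 1) = 1 / (1 - exp (- (2 * s / n)))"
    using assms by (simp add: frac_eq_eq algebra_simps flip: exp_add)
  also have "1 / s + 1 / sinh s - (2 / n) * (1 / (1 - exp (- (2 * s / n))))
      = (1 + s / sinh s - (2 * s / n) / (1 - exp (- (2 * s / n)))) / s"
    using assms by (simp add: diff_divide_distrib add_divide_distrib)
  finally show ?thesis
  proof (rule has_field_derivative_transform_within_open)
    fix x :: real assume "x \<in> {0<..}"
    then have "1 - exp (- x) > 0" "1 + exp (- x) > 0" "exp (2 * x / n) - 1 > 0" "x > 0"
      using assms(1) by (auto intro: add_pos_pos)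
    moreover have "1 + exp (- x) \<noteq> 0" using exp_gt_zero[of "- x"] by linarith
    ultimately show "?G x = ln (lower_bound_fun n x)"
      using assms(1) by (simp add: lower_bound_fun_def ln_mult ln_div add_pos_pos)
  qed (use assms in auto)
qed

lemma ln_upper_bound_fun_derivative:
  assumes "n > 0" "s > 0"
  shows "((\<lambda>s. ln (upper_bound_fun n s)) has_real_derivative
    (1 - s / sinh s - (2 * s / n) / (exp (2 * s / n) - 1)) / s) (at s)"
proof -
  let ?G = "\<lambda>s. ln 2 + ln s + ln (1 + exp (- s)) - ln (1 - exp (- s)) - ln (1 - exp (- (2 * s / n)))"
  have "(?G has_real_derivative
      1 / s + (- exp (- s)) / (1 + exp (- s)) - exp (- s) / (1 - exp (- s)) - (2 / n) * exp (- (2 * s / n)) / (1 - exp (- (2 * s / n)))) (at s)"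
    using assms by (auto intro!: derivative_eq_intros add_pos_pos simp: divide_inverse mult_ac)
  also have "1 / s + (- exp (- s)) / (1 + exp (- s)) - exp (- s) / (1 - exp (- s)) - (2 / n) * exp (- (2 * s / n)) / (1 - exp (- (2 * s / n)))
      = 1 / s - 1 / sinh s - (2 / n) * (exp (- (2 * s / n)) / (1 - exp (- (2 * s / n))))"
    using inverse_sinh_exp[OF assms(2)] by simp
  also have "exp (- (2 * s / n)) / (1 - exp (- (2 * s / n))) = 1 / (exp (2 * s / n) - 1)"
    using assms by (simp add: frac_eq_eq algebra_simps flip: exp_add)
  also have "1 / s - 1 / sinh s - (2 / n) * (1 / (exp (2 * s / n) - 1))
      = (1 - s / sinh s - (2 * s / n) / (exp (2 * s / n) - 1)) / s"
    using assms by (simp add: diff_divide_distrib add_divide_distrib)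
  finally show ?thesis
  proof (rule has_field_derivative_transform_within_open)
    fix x :: real assume "x \<in> {0<..}"
    then have "1 - exp (- x) > 0" "1 + exp (- x) > 0" "1 - exp (- (2 * x / n)) > 0" "x > 0"
      using assms(1) by (auto intro: add_pos_pos)
    moreover have "1 + exp (- x) \<noteq> 0" using exp_gt_zero[of "- x"] by linarith
    ultimately show "?G x = ln (upper_bound_fun n x)"
      using assms(1) by (simp add: upper_bound_fun_def ln_mult ln_div add_pos_pos)
  qed (use assms in auto)
qed

text \<open>The scaled logarithmic derivative \<open>\<phi>\<close> is strictly decreasing, positive near \<open>0\<close>, and negative at
\<open>arsinh n\<close>; its zero is the maximum.\<close>

lemma lower_bound_fun_maximum:
  fixes n :: real
  assumes "n > 0"
  obtains m where "0 < m" "m < arsinh n" "\<And>s. s > 0 \<Longrightarrow> s \<noteq> m \<Longrightarrow> lower_bound_fun n s < lower_bound_fun n m"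
proof -
  define \<phi> where "\<phi> s = 1 + s / sinh s - (2 * s / n) / (1 - exp (- (2 * s / n)))" for s
  have \<phi>_less: "\<phi> t < \<phi> s" if "0 < s" "s < t" for s t
    using strict_antimono_div_sinh[OF that] strict_mono_div_one_minus_exp[of "2 * s / n" "2 * t / n"] that assms
    by (simp add: \<phi>_def divide_strict_right_mono)
  have s0: "arsinh n > 0" and s1: "0 < arsinh (n / 4)" "arsinh (n / 4) < arsinh n"
    using assms by auto
  have neg: "\<phi> (arsinh n) < 0"
    using one_plus_half_less_div_one_minus_exp[of "2 * arsinh n / n"] s0 assms by (simp add: \<phi>_def)
  have pos: "\<phi> (arsinh (n / 4)) > 0"
  proof -
    \<comment> \<open>At this point \<open>s / sinh s = 4 s / n = 2 y\<close>, and \<open>y / (1 - exp (- y)) \<le> 1 + y\<close>.\<close>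
    define y where "y = 2 * arsinh (n / 4) / n"
    have y: "y > 0" using s1 assms by (simp add: y_def)
    have "y \<le> exp y - 1" using exp_ge_add_one_self[of y] by linarith
    then have "y / (exp y - 1) \<le> 1" using y by (subst pos_divide_le_eq) auto
    moreover have "\<phi> (arsinh (n / 4)) = 1 + 2 * y - y / (1 - exp (- y))"
      by (simp add: \<phi>_def y_def)
    ultimately show ?thesis using y div_one_minus_exp[OF y] by linarith
  qed
  have "sinh s \<noteq> 0 \<and> exp (- (2 * s / n)) \<noteq> 1" if "s \<in> {arsinh (n / 4)..arsinh n}" for s
    using that s1(1) assms by (simp del: arsinh_real_pos_iff)
  then have "continuous_on {arsinh (n / 4)..arsinh n} \<phi>"
    unfolding \<phi>_def using assms by (intro continuous_intros) auto
  then have "\<exists>m\<ge>arsinh (n / 4). m \<le> arsinh n \<and> \<phi> m = 0"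
    using neg pos s1 by (intro IVT2') (simp_all del: arsinh_less_iff_real)
  then obtain m where m: "arsinh (n / 4) \<le> m" "m \<le> arsinh n" "\<phi> m = 0"
    by blast
  have "m > 0" using m s1 by linarith
  moreover have "m < arsinh n" using m neg by (cases "m = arsinh n") auto
  moreover have "lower_bound_fun n s < lower_bound_fun n m" if "s > 0" "s \<noteq> m" for s
  proof -
    have "ln (lower_bound_fun n s) < ln (lower_bound_fun n m)"
    proof (rule strict_maximum_if_derivative_sign[where m = m and F = "\<lambda>s. ln (lower_bound_fun n s)"])
      show "((\<lambda>s. ln (lower_bound_fun n s)) has_real_derivative \<phi> s / s) (at s)" if "s > 0" for s
        unfolding \<phi>_def by (rule ln_lower_bound_fun_derivative[OF assms that])
      show "\<phi> s / s > 0" if "0 < s" "s < m" for s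
        using \<phi>_less[OF that] m(3) that by simp
      show "\<phi> s / s < 0" if "m < s" for s
        using \<phi>_less[OF \<open>m > 0\<close> that] m(3) that \<open>m > 0\<close> by (simp add: divide_neg_pos)
    qed (use that \<open>m > 0\<close> in auto)
    then show ?thesis
      using lower_bound_fun_pos[OF assms] that \<open>m > 0\<close> by simp
  qed
  ultimately show ?thesis by (rule that)
qed

text \<open>The scaled logarithmic derivative \<open>\<phi>\<close> is strictly increasing, negative at \<open>arsinh n\<close>, and positive for large
\<open>s\<close>; its zero is the minimum.\<close>

lemma upper_bound_fun_minimum:
  fixes n :: real
  assumes "n \<ge> 1"
  obtains m where "0 < m" "arsinh n < m" "\<And>s. s > 0 \<Longrightarrow> s \<noteq> m \<Longrightarrow> upper_bound_fun n m < upper_bound_fun n s"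
proof -
  define \<phi> where "\<phi> s = 1 - s / sinh s - (2 * s / n) / (exp (2 * s / n) - 1)" for s
  have n: "n > 0" using assms by simp
  have \<phi>_less: "\<phi> s < \<phi> t" if "0 < s" "s < t" for s t
    using strict_antimono_div_sinh[OF that] strict_antimono_div_exp_minus_one[of "2 * s / n" "2 * t / n"] that n
    by (simp add: \<phi>_def divide_strict_right_mono)
  have s0: "arsinh n > 0"
    using n by auto
  have neg: "\<phi> (arsinh n) < 0"
  proof -
    define y where "y = 2 * arsinh n / n"
    have y: "y > 0" using s0 n by (simp add: y_def)
    have "\<phi> (arsinh n) = 1 - y / 2 - y / (exp y - 1)"
      by (simp add: \<phi>_def y_def)
    then show ?thesis
      using one_plus_half_less_div_one_minus_exp[OF y] div_one_minus_exp[OF y] by linarith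
  qed
  have pos: "\<phi> (6 * n) > 0"
  proof -
    \<comment> \<open>Any large multiple of \<open>n\<close> works; here \<open>y = 12\<close>, and quadratic lower bounds for \<open>exp\<close> bound the two subtracted
      terms by \<open>1 / 2\<close> and \<open>1 / 7\<close>.\<close>
    have e12: "exp (12::real) - 1 \<ge> 12 + 72"
      using exp_lower_Taylor_quadratic[of "12::real"] by simp
    have "exp (6 * n) \<ge> 1 + 6 * n + (6 * n)\<^sup>2 / 2"
      using n by (intro exp_lower_Taylor_quadratic) simp
    moreover have "(6 * n)\<^sup>2 / 2 \<ge> 18 * n"
      using assms by (simp add: power2_eq_square)
    moreover have "exp (- (6 * n)) \<le> 1" using n by simp
    moreover have "2 * sinh (6 * n) = exp (6 * n) - exp (- (6 * n))"
      by (simp add: sinh_field_def)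
    ultimately have "2 * sinh (6 * n) \<ge> 24 * n"
      by linarith
    then have "6 * n / sinh (6 * n) \<le> 1 / 2" using n by (simp add: field_simps)
    moreover have "12 / (exp 12 - 1) \<le> (1 / 7 :: real)" using e12 by (simp add: field_simps)
    moreover have "\<phi> (6 * n) = 1 - 6 * n / sinh (6 * n) - 12 / (exp 12 - 1)"
      using n by (simp add: \<phi>_def)
    ultimately show ?thesis by linarith
  qed
  have order: "arsinh n < 6 * n"
    using neg pos \<phi>_less[of "6 * n" "arsinh n"] n by (cases "arsinh n = 6 * n") force+
  have "sinh s \<noteq> 0 \<and> exp (2 * s / n) - 1 \<noteq> 0" if "s \<in> {arsinh n..6 * n}" for s
    using that s0 n by (simp del: arsinh_real_pos_iff)
  then have "continuous_on {arsinh n..6 * n} \<phi>"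
    unfolding \<phi>_def using n by (intro continuous_intros) auto
  then have "\<exists>m\<ge>arsinh n. m \<le> 6 * n \<and> \<phi> m = 0"
    using neg pos order by (intro IVT') simp_all
  then obtain m where m: "arsinh n \<le> m" "m \<le> 6 * n" "\<phi> m = 0"
    by blast
  have "m > 0" using m s0 by linarith
  moreover have "arsinh n < m" using m neg by (cases "m = arsinh n") auto
  moreover have "upper_bound_fun n m < upper_bound_fun n s" if "s > 0" "s \<noteq> m" for s
  proof -
    have "- ln (upper_bound_fun n s) < - ln (upper_bound_fun n m)"
    proof (rule strict_maximum_if_derivative_sign[where m = m and F = "\<lambda>s. - ln (upper_bound_fun n s)"])
      show "((\<lambda>s. - ln (upper_bound_fun n s)) has_real_derivative - (\<phi> s / s)) (at s)" if "s > 0" for s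
        unfolding \<phi>_def by (intro DERIV_minus ln_upper_bound_fun_derivative[OF n that])
          show "- (\<phi> s / s) > 0" if "0 < s" "s < m" for s
        using \<phi>_less[OF that] m(3) that by (simp add: divide_neg_pos)
      show "- (\<phi> s / s) < 0" if "m < s" for s
        using \<phi>_less[OF \<open>m > 0\<close> that] m(3) that \<open>m > 0\<close> by simp
    qed (use that \<open>m > 0\<close> in auto)
    then show ?thesis
      using upper_bound_fun_pos[OF n] that \<open>m > 0\<close> by simp
  qed
  ultimately show ?thesis by (rule that)
qed

text \<open>In the quotient everything but the two hyperbolic sine terms and the constant \<open>2 / n\<close> cancels from the logarithmic derivative,
which leaves \<open>2 / n - 2 / sinh s\<close>.\<close>

lemma condition_number_fun_minimum:
  fixes n s :: real
  assumes "n > 0" "s > 0" "s \<noteq> arsinh n"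
  shows "upper_bound_fun n (arsinh n) / lower_bound_fun n (arsinh n) < upper_bound_fun n s / lower_bound_fun n s"
proof -
  let ?K = "\<lambda>s. upper_bound_fun n s / lower_bound_fun n s"
  have pos: "?K s > 0" if "s > 0" for s
    using lower_bound_fun_pos upper_bound_fun_pos assms(1) that by simp
  have "- ln (?K s) < - ln (?K (arsinh n))"
  proof (rule strict_maximum_if_derivative_sign[where m = "arsinh n" and F = "\<lambda>s. - ln (?K s)"])
    fix s :: real assume s: "s > 0"
    let ?y = "2 * s / n"
    have y: "?y > 0" using s assms(1) by simp
    have yy: "?y / (1 - exp (- ?y)) = ?y + ?y / (exp ?y - 1)"
      using y by (rule div_one_minus_exp)
    have "((\<lambda>s. ln (lower_bound_fun n s) - ln (upper_bound_fun n s)) has_real_derivative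
        (1 + s / sinh s - ?y / (1 - exp (- ?y))) / s - (1 - s / sinh s - ?y / (exp ?y - 1)) / s) (at s)"
      by (intro DERIV_diff ln_lower_bound_fun_derivative ln_upper_bound_fun_derivative assms s)
    also have "(1 + s / sinh s - ?y / (1 - exp (- ?y))) / s - (1 - s / sinh s - ?y / (exp ?y - 1)) / s
        = 2 / sinh s - 2 / n"
      unfolding yy using s by (simp add: diff_divide_distrib add_divide_distrib)
    finally show "((\<lambda>s. - ln (?K s)) has_real_derivative 2 / sinh s - 2 / n) (at s)"
    proof (rule has_field_derivative_transform_within_open)
      fix x :: real assume "x \<in> {0<..}"
      then show "ln (lower_bound_fun n x) - ln (upper_bound_fun n x) = - ln (?K x)"
        using lower_bound_fun_pos[of n x] upper_bound_fun_pos[of n x] assms(1) by (simp add: ln_div)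
    qed (use s in auto)
  next
    fix s :: real assume s: "0 < s" "s < arsinh n"
    then have "sinh s < sinh (arsinh n)" by (simp only: sinh_real_less_iff)
    then show "2 / sinh s - 2 / n > 0"
      using s assms(1) divide_strict_left_mono[of "sinh s" n 2] by simp
  next
    fix s :: real assume s: "arsinh n < s"
    then have "sinh (arsinh n) < sinh s" by (simp only: sinh_real_less_iff)
    then have less: "n < sinh s" by simp
    then have "0 < sinh s" using assms(1) by linarith
    then have "0 < sinh s * n" using assms(1) by (rule mult_pos_pos)
    then show "2 / sinh s - 2 / n < 0"
      using divide_strict_left_mono[OF less, of 2] by simp
  qed (use assms in auto)
  then show ?thesis
    using pos[of s] pos[of "arsinh n"] assms by simp
qed

section \<open>Comparing lattices\<close>

lemma rect_lattices_param:
  assumes "n > 0"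
  shows "rect_lattices n = {rect_lattice (\<eta> / n) (1 / \<eta>) | \<eta>. \<eta> > 0}"
proof (intro set_eqI iffI)
  fix \<Lambda> assume "\<Lambda> \<in> rect_lattices n"
  then obtain a b where ab: "a > 0" "b > 0" "inverse (a * b) = n" "\<Lambda> = rect_lattice a b"
    by (auto simp: rect_lattices_def)
  then have "a * b * n = a * b * inverse (a * b)" by (simp only:)
  also have "\<dots> = 1" using ab(1,2) by (intro right_inverse) auto
  finally have "a * b * n = 1" .
  then have "a = 1 / b / n"
    using ab(2) assms by (simp add: eq_divide_eq mult.assoc)
  with ab have "1 / b > 0 \<and> \<Lambda> = rect_lattice (1 / b / n) (1 / (1 / b))" by auto
  then show "\<Lambda> \<in> {rect_lattice (\<eta> / n) (1 / \<eta>) | \<eta>. \<eta> > 0}" by blast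
next
  fix \<Lambda> assume "\<Lambda> \<in> {rect_lattice (\<eta> / n) (1 / \<eta>) | \<eta>. \<eta> > 0}"
  then obtain \<eta> where \<eta>: "\<eta> > 0" "\<Lambda> = rect_lattice (\<eta> / n) (1 / \<eta>)" by blast
  moreover have "inverse (\<eta> / n * (1 / \<eta>)) = n" "\<eta> / n > 0" "1 / \<eta> > 0" using \<eta>(1) assms by auto
  ultimately show "\<Lambda> \<in> rect_lattices n"
    unfolding rect_lattices_def by blast
qed

text \<open>With \<open>R\<close> the order or its converse, this serves minima and maxima alike.\<close>

lemma rect_lattices_strict_extremum:
  assumes "\<gamma> > 0" "n > 0" "m > 0"
    and \<Phi>: "\<And>\<eta>. \<eta> > 0 \<Longrightarrow> \<Phi> (rect_lattice (\<eta> / n) (1 / \<eta>)) = G (\<gamma> * \<eta>)"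
    and R: "\<And>s. s > 0 \<Longrightarrow> s \<noteq> m \<Longrightarrow> R (G m) (G s)"
  defines "M \<equiv> rect_lattice (m / \<gamma> / n) (1 / (m / \<gamma>))"
  shows "M \<in> rect_lattices n"
    and "\<Lambda> \<in> rect_lattices n \<Longrightarrow> \<Lambda> \<noteq> M \<Longrightarrow> R (\<Phi> M) (\<Phi> \<Lambda>)"
proof -
  have m: "m / \<gamma> > 0" "\<gamma> * (m / \<gamma>) = m" using assms(1,3) by auto
  then show "M \<in> rect_lattices n"
    unfolding M_def rect_lattices_param[OF assms(2)] by blast
  assume "\<Lambda> \<in> rect_lattices n" and ne: "\<Lambda> \<noteq> M"
  then obtain \<eta> where \<eta>: "\<eta> > 0" "\<Lambda> = rect_lattice (\<eta> / n) (1 / \<eta>)"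
    unfolding rect_lattices_param[OF assms(2)] by blast
  then have "\<gamma> * \<eta> \<noteq> m" using ne assms(1) by (auto simp: M_def)
  then have "R (G m) (G (\<gamma> * \<eta>))" using R \<eta>(1) assms(1) by simp
  then show "R (\<Phi> M) (\<Phi> \<Lambda>)"
    unfolding M_def \<eta>(2) \<Phi>[OF \<eta>(1)] \<Phi>[OF m(1)] m(2) .
qed

lemma is_arg_min_rect_lattices:
  fixes \<Phi> :: "(real \<times> real) set \<Rightarrow> 'b :: linorder" and G :: "real \<Rightarrow> 'b"
  assumes "\<gamma> > 0" "n > 0" "m > 0"
    and "\<And>\<eta>. \<eta> > 0 \<Longrightarrow> \<Phi> (rect_lattice (\<eta> / n) (1 / \<eta>)) = G (\<gamma> * \<eta>)"
    and "\<And>s. s > 0 \<Longrightarrow> s \<noteq> m \<Longrightarrow> G m < G s"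
  shows "is_arg_min \<Phi> (\<lambda>\<Lambda>. \<Lambda> \<in> rect_lattices n) \<Lambda> \<longleftrightarrow> \<Lambda> = rect_lattice (m / \<gamma> / n) (1 / (m / \<gamma>))"
  using rect_lattices_strict_extremum[of \<gamma> n m \<Phi> G "(<)", OF assms]
  unfolding is_arg_min_def by (metis less_asym less_irrefl)

lemma is_arg_max_rect_lattices:
  fixes \<Phi> :: "(real \<times> real) set \<Rightarrow> 'b :: linorder" and G :: "real \<Rightarrow> 'b"
  assumes "\<gamma> > 0" "n > 0" "m > 0"
    and "\<And>\<eta>. \<eta> > 0 \<Longrightarrow> \<Phi> (rect_lattice (\<eta> / n) (1 / \<eta>)) = G (\<gamma> * \<eta>)"
    and "\<And>s. s > 0 \<Longrightarrow> s \<noteq> m \<Longrightarrow> G s < G m"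
  shows "is_arg_max \<Phi> (\<lambda>\<Lambda>. \<Lambda> \<in> rect_lattices n) \<Lambda> \<longleftrightarrow> \<Lambda> = rect_lattice (m / \<gamma> / n) (1 / (m / \<gamma>))"
  using rect_lattices_strict_extremum[of \<gamma> n m \<Phi> G "\<lambda>x y. y < x", OF assms]
  unfolding is_arg_max_def by (metis less_asym less_irrefl)

theorem theorem2p6:
  fixes \<gamma> :: real and n :: nat
  assumes "\<gamma> > 0" and "n \<ge> 1"
  shows "(\<forall>\<Lambda>. is_arg_min (frame_condition_number (one_sided_exp \<gamma>))
              (\<lambda>\<Lambda>. \<Lambda> \<in> rect_lattices (real n)) \<Lambda>
            \<longleftrightarrow> \<Lambda> = rect_lattice (arsinh (real n) / \<gamma> / real n) (1 / (arsinh (real n) / \<gamma>)))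
    \<and> (\<exists>a\<^sub>p>0. a\<^sub>p < arsinh (real n) / \<gamma> \<and>
          (\<forall>\<Lambda>. is_arg_max (sharp_lower_frame_bound (one_sided_exp \<gamma>))
              (\<lambda>\<Lambda>. \<Lambda> \<in> rect_lattices (real n)) \<Lambda>
            \<longleftrightarrow> \<Lambda> = rect_lattice (a\<^sub>p / real n) (1 / a\<^sub>p)))
    \<and> (\<exists>a\<^sub>m>0. a\<^sub>m > arsinh (real n) / \<gamma> \<and>
          (\<forall>\<Lambda>. is_arg_min (sharp_upper_frame_bound (one_sided_exp \<gamma>))
              (\<lambda>\<Lambda>. \<Lambda> \<in> rect_lattices (real n)) \<Lambda>
            \<longleftrightarrow> \<Lambda> = rect_lattice (a\<^sub>m / real n) (1 / a\<^sub>m)))"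
proof (intro conjI)
  have n: "n > 0" "real n > 0" "real n \<ge> 1" using assms(2) by auto
  note lower = sharp_lower_frame_bound_one_sided_exp[OF assms(1) _ n(1)]
  note upper = sharp_upper_frame_bound_one_sided_exp[OF assms(1) _ n(1)]
  note pos = lower_bound_fun_pos[OF n(2)] upper_bound_fun_pos[OF n(2)]
  let ?K = "\<lambda>s. upper_bound_fun n s / lower_bound_fun n s"
  have "frame_condition_number (one_sided_exp \<gamma>) (rect_lattice (\<eta> / n) (1 / \<eta>)) = ennreal (?K (\<gamma> * \<eta>))"
    if "\<eta> > 0" for \<eta>
    using pos[of "\<gamma> * \<eta>"] that assms(1)
    by (simp add: frame_condition_number_def lower upper divide_ennreal)
  moreover have "ennreal (?K (arsinh n)) < ennreal (?K s)" if "s > 0" "s \<noteq> arsinh n" for s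
    using that by (intro ennreal_lessI divide_pos_pos pos condition_number_fun_minimum n)
  ultimately show "\<forall>\<Lambda>. is_arg_min (frame_condition_number (one_sided_exp \<gamma>)) (\<lambda>\<Lambda>. \<Lambda> \<in> rect_lattices (real n)) \<Lambda>
      \<longleftrightarrow> \<Lambda> = rect_lattice (arsinh (real n) / \<gamma> / real n) (1 / (arsinh (real n) / \<gamma>))"
    using n by (intro allI is_arg_min_rect_lattices[where G = "\<lambda>s. ennreal (?K s)"] assms(1)) auto
  obtain m where m: "0 < m" "m < arsinh n" "\<And>s. s > 0 \<Longrightarrow> s \<noteq> m \<Longrightarrow> lower_bound_fun n s < lower_bound_fun n m"
    using lower_bound_fun_maximum[OF n(2)] by blast
  have "is_arg_max (sharp_lower_frame_bound (one_sided_exp \<gamma>)) (\<lambda>\<Lambda>. \<Lambda> \<in> rect_lattices (real n)) \<Lambda>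
      \<longleftrightarrow> \<Lambda> = rect_lattice (m / \<gamma> / real n) (1 / (m / \<gamma>))" for \<Lambda>
    by (rule is_arg_max_rect_lattices[where G = "\<lambda>s. ennreal (lower_bound_fun n s)", OF assms(1) n(2) m(1) lower])
      (auto intro!: ennreal_lessI pos m)
  then show "\<exists>a\<^sub>p>0. a\<^sub>p < arsinh (real n) / \<gamma> \<and>
      (\<forall>\<Lambda>. is_arg_max (sharp_lower_frame_bound (one_sided_exp \<gamma>)) (\<lambda>\<Lambda>. \<Lambda> \<in> rect_lattices (real n)) \<Lambda>
        \<longleftrightarrow> \<Lambda> = rect_lattice (a\<^sub>p / real n) (1 / a\<^sub>p))"
    using m assms(1) by (intro exI[of _ "m / \<gamma>"]) (auto simp: divide_strict_right_mono)
  obtain m' where m': "0 < m'" "arsinh n < m'" "\<And>s. s > 0 \<Longrightarrow> s \<noteq> m' \<Longrightarrow> upper_bound_fun n m' < upper_bound_fun n s"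
    using upper_bound_fun_minimum[OF n(3)] by blast
  have "is_arg_min (sharp_upper_frame_bound (one_sided_exp \<gamma>)) (\<lambda>\<Lambda>. \<Lambda> \<in> rect_lattices (real n)) \<Lambda>
      \<longleftrightarrow> \<Lambda> = rect_lattice (m' / \<gamma> / real n) (1 / (m' / \<gamma>))" for \<Lambda>
    by (rule is_arg_min_rect_lattices[where G = "\<lambda>s. ennreal (upper_bound_fun n s)", OF assms(1) n(2) m'(1) upper])
      (auto intro!: ennreal_lessI pos m')
  then show "\<exists>a\<^sub>m>0. a\<^sub>m > arsinh (real n) / \<gamma> \<and>
      (\<forall>\<Lambda>. is_arg_min (sharp_upper_frame_bound (one_sided_exp \<gamma>)) (\<lambda>\<Lambda>. \<Lambda> \<in> rect_lattices (real n)) \<Lambda>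
        \<longleftrightarrow> \<Lambda> = rect_lattice (a\<^sub>m / real n) (1 / a\<^sub>m))"
    using m' assms(1) by (intro exI[of _ "m' / \<gamma>"]) (auto simp: divide_strict_right_mono)
qed

end
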